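(* Let $F\in\mathcal F$ satisfy $F=o(|\mathbf x|^{-2})$ as $|\mathbf x|\to+\infty$, with $\partial_iF$ integrable in a neighbourhood of infinity. Then for each $i\in\{1,2,3\}$ (and for any choice of the constants $s_1,s_2>0$) $$\mathrm{Pf}_{s_1,s_2}\int d^3\mathbf x~\partial_iF=-4\pi\,\bigl(n_1^i\,r_1^2F\bigr)_1-4\pi\,\bigl(n_2^i\,r_2^2F\bigr)_2 ,$$ where $\partial_iF$ is the ordinary gradient of $F$ on $\mathbb R^3\setminus\{\mathbf y_1,\mathbf y_2\}$.
   Context: Fix two distinct points $\mathbf y_1,\mathbf y_2\in\mathbb R^3$. For $\mathbf x\in\mathbb R^3$ put $r_1=|\mathbf x-\mathbf y_1|$, $\mathbf n_1=(\mathbf x-\mathbf y_1)/r_1$, $r_2=|\mathbf x-\mathbf y_2|$, $\mathbf n_2=(\mathbf x-\mathbf y_2)/r_2$; $n_1^i$ is the $i$-th component of $\mathbf n_1$, and $d\Omega_1$, $d\Omega_2$ are the solid angle elements of $\mathbf n_1$, $\mathbf n_2$. Class $\mathcal F$: real functions $F$, smooth on $\mathbb R^3\setminus\{\mathbf y_1,\mathbf y_2\}$, for which there are real exponents $a_0<a_1<a_2<\cdots$ (only finitely many below any bound) and functions ${}_1f_{a}$ on the unit sphere such that for all $N\in\mathbb N$, $F=\sum_{a\le N}r_1^{a}\,{}_1f_{a}(\mathbf n_1)+o(r_1^N)$ as $r_1\to0$ (uniformly in $\mathbf n_1$); and similarly at $\mathbf y_2$ with exponents $b$ and coefficients ${}_2f_b(\mathbf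 n_2)$. Put ${}_1f_a=0$ if $a$ is not one of the exponents. The coefficients are smooth on the sphere and the expansions may be differentiated term by term, so that $\partial_iF\in\mathcal F$. Partie finie at a point: $(F)_1=\int\frac{d\Omega_1}{4\pi}\,{}_1f_0(\mathbf n_1)$, the angular average of the coefficient of $r_1^0$ in the expansion at $\mathbf y_1$; similarly $(F)_2$. (Here $n_1^ir_1^2F$ is expanded near $\mathbf y_1$, and $n_2^ir_2^2F$ near $\mathbf y_2$.) Partie finie of an integral: with $\mathcal B_{1}(s),\mathcal B_2(s)$ the closed balls of radius $s$ centred at $\mathbf y_{1},\mathbf y_2$, and $s_1,s_2>0$ fixed constants, for $F\in\mathcal F$ integrable near infinity, $$\mathrm{Pf}_{s_1,s_2}\int d^3\mathbf x\,F=\lim_{s\to0}\Bigl\{\int_{\mathbb R^3\setminus\mathcal B_1(s)\cup\mathcal B_2(s)}d^3\mathbf x\,F+\sum_{a+3<0}\frac{s^{a+3}}{a+3}\int d\Omega_1\,{}_1f_a+\ln\Bigl(\frac s{s_1}\Bigr)\int d\Omega_1\,{}_1f_{-3}+\sum_{b+3<0}\frac{s^{b+3}}{b+3}\int d\Omega_2\,{}_2f_b+\ln\Bigl(\frac s{s_2}\Bigr)\int d\Omega_2\,{}_2f_{-3}\Bigr\}.$$ *)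

theory Defs
  imports "HOL-Analysis.Analysis" "HOL-Library.Landau_Symbols"
begin

definition partial :: "3 \<Rightarrow> (real^3 \<Rightarrow> real) \<Rightarrow> real^3 \<Rightarrow> real" where
  "partial i F x = frechet_derivative F (at x) (axis i 1)"

abbreviation iter_partial :: "3 list \<Rightarrow> (real^3 \<Rightarrow> real) \<Rightarrow> real^3 \<Rightarrow> real" where
  "iter_partial ds F \<equiv> foldr partial ds F"

text \<open>For open \<open>S\<close> this is \<open>C\<^sup>\<infinity>\<close> smoothness: differentiability of all iterated partial derivatives
  gives their continuity.\<close>
definition smooth_on :: "(real^3) set \<Rightarrow> (real^3 \<Rightarrow> real) \<Rightarrow> bool" where
  "smooth_on S F \<longleftrightarrow> (\<forall>ds. iter_partial ds F differentiable_on S)"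

definition smooth_on_sphere :: "(real^3 \<Rightarrow> real) \<Rightarrow> bool" where
  "smooth_on_sphere f \<longleftrightarrow>
     (\<exists>U g. open U \<and> sphere 0 1 \<subseteq> U \<and> smooth_on U g \<and> (\<forall>n\<in>sphere 0 1. g n = f n))"

definition unit_dir :: "real^3 \<Rightarrow> real^3 \<Rightarrow> real^3" where
  "unit_dir y x = (x - y) /\<^sub>R norm (x - y)"

text \<open>The integral over all directions against the solid angle element
  \<open>sin \<theta> d\<theta> d\<phi>\<close> (polar angle \<open>\<theta>\<close>, azimuth \<open>\<phi>\<close>).\<close>
definition angular_integral :: "(real^3 \<Rightarrow> real) \<Rightarrow> real" where
  "angular_integral f =
     (LINT \<theta>:{0..pi}|lborel. LINT \<phi>:{0..2 * pi}|lborel.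
        f (vector [sin \<theta> * cos \<phi>, sin \<theta> * sin \<phi>, cos \<theta>]) * sin \<theta>)"

definition radial_term :: "real^3 \<Rightarrow> real \<Rightarrow> (real^3 \<Rightarrow> real) \<Rightarrow> real^3 \<Rightarrow> real" where
  "radial_term y a f x = norm (x - y) powr a * f (unit_dir y x)"

text \<open>\<open>A\<close> is the set of exponents and \<open>c a\<close> the coefficient of exponent \<open>a\<close>. Coefficients are
  functions on the unit sphere, represented by functions on the whole space vanishing off the sphere,
  so that \<open>c\<close> is determined by \<open>F\<close>. Uniformity of the remainder in the direction is built into
  the filter \<open>at y\<close>.\<close>
definition expansion_at ::
    "real^3 \<Rightarrow> (real^3 \<Rightarrow> real) \<Rightarrow> real set \<Rightarrow> (real \<Rightarrow> real^3 \<Rightarrow> real) \<Rightarrow> bool" where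
  "expansion_at y F A c \<longleftrightarrow>
     (\<forall>M. finite {a\<in>A. a \<le> M}) \<and>
     (\<forall>a n. a \<notin> A \<or> n \<notin> sphere 0 1 \<longrightarrow> c a n = 0) \<and>
     (\<forall>N::nat. (\<lambda>x. F x - (\<Sum>a | a \<in> A \<and> a \<le> real N. radial_term y a (c a) x))
                 \<in> o[at y](\<lambda>x. norm (x - y) ^ N))"

text \<open>Term-by-term differentiation: differentiating \<open>k\<close> times lowers each radial exponent
  \<open>a\<close> to \<open>a - k\<close>, so the terms up to order \<open>N\<close> are those with \<open>a \<le> N + k\<close>.\<close>
definition smooth_expansion_at ::
    "real^3 \<Rightarrow> (real^3 \<Rightarrow> real) \<Rightarrow> real set \<Rightarrow> (real \<Rightarrow> real^3 \<Rightarrow> real) \<Rightarrow> bool" where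
  "smooth_expansion_at y F A c \<longleftrightarrow>
     expansion_at y F A c \<and>
     (\<forall>a\<in>A. smooth_on_sphere (c a)) \<and>
     (\<forall>ds. \<forall>N::nat.
        (\<lambda>x. iter_partial ds F x -
              (\<Sum>a | a \<in> A \<and> a \<le> real N + real (length ds).
                 iter_partial ds (radial_term y a (c a)) x))
          \<in> o[at y](\<lambda>x. norm (x - y) ^ N))"

definition class_F :: "real^3 \<Rightarrow> real^3 \<Rightarrow> (real^3 \<Rightarrow> real) set" where
  "class_F y1 y2 = {F. smooth_on (- {y1, y2}) F \<and>
     (\<exists>A c. smooth_expansion_at y1 F A c) \<and> (\<exists>B d. smooth_expansion_at y2 F B d)}"

definition coeff_at :: "real^3 \<Rightarrow> (real^3 \<Rightarrow> real) \<Rightarrow> real \<Rightarrow> real^3 \<Rightarrow> real" where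
  "coeff_at y F = (THE c. \<exists>A. expansion_at y F A c)"

definition pf_point :: "real^3 \<Rightarrow> (real^3 \<Rightarrow> real) \<Rightarrow> real" where
  "pf_point y F = angular_integral (coeff_at y F 0) / (4 * pi)"

text \<open>Exponents with vanishing coefficient contribute nothing, so the sum may range over the
  exponents with nonzero coefficient.\<close>
definition pf_counterterm :: "real^3 \<Rightarrow> real \<Rightarrow> (real^3 \<Rightarrow> real) \<Rightarrow> real \<Rightarrow> real" where
  "pf_counterterm y \<sigma> F s =
     (\<Sum>a | a + 3 < 0 \<and> (\<exists>n. coeff_at y F a n \<noteq> 0).
        s powr (a + 3) / (a + 3) * angular_integral (coeff_at y F a))
     + ln (s / \<sigma>) * angular_integral (coeff_at y F (-3))"

text \<open>\<open>Pf\<^bsub>s1,s2\<^esub> \<integral> F = I\<close>, including the existence of the limit.\<close>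
definition has_pf_integral ::
    "real^3 \<Rightarrow> real^3 \<Rightarrow> real \<Rightarrow> real \<Rightarrow> (real^3 \<Rightarrow> real) \<Rightarrow> real \<Rightarrow> bool" where
  "has_pf_integral y1 y2 s1 s2 F I \<longleftrightarrow>
     ((\<lambda>s. (LINT x:- (cball y1 s \<union> cball y2 s)|lborel. F x)
            + pf_counterterm y1 s1 F s + pf_counterterm y2 s2 F s) \<longlongrightarrow> I) (at_right 0)"

definition integrable_near_infinity :: "(real^3 \<Rightarrow> real) \<Rightarrow> bool" where
  "integrable_near_infinity F \<longleftrightarrow> (\<exists>R. set_integrable lborel {x. norm x > R} F)"

end

theory Submission
  imports Defs
begin

text \<open>
  Near \<open>y\<close> let \<open>flux i y F r\<close> be the integral of \<open>n\<^sup>i F\<close> over the sphere of radius \<open>r\<close> about \<open>y\<close>.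
  Writing the Cartesian divergence in spherical coordinates, the angular derivatives integrate to
  zero, so the \<open>r\<close>-derivative of the flux is \<open>r\<^sup>2\<close> times the angular integral of \<open>\<partial>\<^sub>i F\<close>. Integrating in \<open>r\<close> and
  splitting \<open>F\<close> with a bump function that isolates one singularity from the other, the integral of \<open>\<partial>\<^sub>i F\<close>
  outside the two small balls is minus the sum of the two fluxes; the flux at infinity vanishes
  because \<open>F = o(|x|\<^sup>-\<^sup>2)\<close>.

  Applied instead to the homogeneous function \<open>r\<^sup>a f(n)\<close>, whose flux is a multiple of \<open>r\<^sup>a\<^sup>+\<^sup>2\<close>, the same identity
  shows that the angular integral of the coefficient of \<open>r\<^sup>a\<^sup>-\<^sup>1\<close> in \<open>\<partial>\<^sub>i F\<close> is \<open>a + 2\<close> times that of \<open>n\<^sup>i f\<close>.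
  Hence there is no logarithm, the counterterms cancel exactly the divergent part of the flux, and
  what remains is the constant term of the flux, coming from the coefficient of \<open>r\<^sup>-\<^sup>2\<close> in \<open>F\<close>.
\<close>

subsection \<open>Spherical coordinates and the flux\<close>

text \<open>\<open>sph\<close>, \<open>sph_theta\<close> and \<open>sph_phi\<close> form the
  orthonormal frame e_r, e_theta, e_phi at polar angle \<open>fst p\<close> and azimuth
  \<open>snd p\<close>. The last is the azimuthal derivative of \<open>sph\<close> with its factor
  sin theta removed, so that the frame stays orthonormal at the poles.\<close>

definition sph :: "real \<times> real \<Rightarrow> real^3" where
  "sph p = vector [sin (fst p) * cos (snd p), sin (fst p) * sin (snd p), cos (fst p)]"

definition sph_theta :: "real \<times> real \<Rightarrow> real^3" where
  "sph_theta p = vector [cos (fst p) * cos (snd p), cos (fst p) * sin (snd p), - sin (fst p)]"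

definition sph_phi :: "real \<times> real \<Rightarrow> real^3" where
  "sph_phi p = vector [- sin (snd p), cos (snd p), 0]"

lemma sph_nth [simp]:
  "sph p $ 1 = sin (fst p) * cos (snd p)" "sph p $ 2 = sin (fst p) * sin (snd p)"
  "sph p $ 3 = cos (fst p)"
  "sph_theta p $ 1 = cos (fst p) * cos (snd p)" "sph_theta p $ 2 = cos (fst p) * sin (snd p)"
  "sph_theta p $ 3 = - sin (fst p)"
  "sph_phi p $ 1 = - sin (snd p)" "sph_phi p $ 2 = cos (snd p)" "sph_phi p $ 3 = 0"
  by (simp_all add: sph_def sph_theta_def sph_phi_def)

lemma norm_sph [simp]: "norm (sph p) = 1"
proof -
  have "(sin (fst p) * cos (snd p))\<^sup>2 + (sin (fst p) * sin (snd p))\<^sup>2 + (cos (fst p))\<^sup>2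
      = (sin (fst p))\<^sup>2 * ((sin (snd p))\<^sup>2 + (cos (snd p))\<^sup>2) + (cos (fst p))\<^sup>2"
    by algebra
  then show ?thesis
    by (simp add: norm_vec_def L2_set_def sum_3)
qed

text \<open>The frame is orthonormal, so a vector is the sum of its projections. Applied to a
  gradient, this trades a Cartesian derivative for the radial and the two angular ones.\<close>

lemma frame_expansion:
  "sph p $ i * (g \<bullet> sph p) + sph_theta p $ i * (g \<bullet> sph_theta p) + sph_phi p $ i * (g \<bullet> sph_phi p)
    = g $ i"
proof -
  have S: "(sin (fst p))\<^sup>2 = 1 - (cos (fst p))\<^sup>2" "(sin (snd p))\<^sup>2 = 1 - (cos (snd p))\<^sup>2"
    by (auto simp: sin_squared_eq)
  show ?thesis
    using exhaust_3[of i]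
  proof (elim disjE)
    assume i: "i = 1"
    show ?thesis unfolding i inner_vec_def sum_3 sph_nth inner_real_def using S by algebra
  next
    assume i: "i = 2"
    show ?thesis unfolding i inner_vec_def sum_3 sph_nth inner_real_def using S by algebra
  next
    assume i: "i = 3"
    show ?thesis unfolding i inner_vec_def sum_3 sph_nth inner_real_def using S by algebra
  qed
qed

lemma has_derivative_vec_componentwise:
  fixes f :: "'a::real_normed_vector \<Rightarrow> real^'n"
  assumes "\<And>i. ((\<lambda>x. f x $ i) has_derivative (\<lambda>h. f' h $ i)) (at a within S)"
  shows "(f has_derivative f') (at a within S)"
  using assms
  by (subst has_derivative_componentwise_within)
     (auto simp: Basis_vec_def inner_axis)

lemma has_derivative_compose_o:
  "(f has_derivative f') (at x) \<Longrightarrow> (g has_derivative g') (at (f x))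
    \<Longrightarrow> ((\<lambda>x. g (f x)) has_derivative (g' \<circ> f')) (at x)"
  using diff_chain_at[of f f' x g g'] by (simp add: o_def)

lemma sph_has_derivative:
  "(sph has_derivative (\<lambda>h. fst h *\<^sub>R sph_theta p + (snd h * sin (fst p)) *\<^sub>R sph_phi p)) (at p within A)"
proof (rule has_derivative_vec_componentwise)
  fix i :: 3
  show "((\<lambda>x. sph x $ i) has_derivative
         (\<lambda>h. (fst h *\<^sub>R sph_theta p + (snd h * sin (fst p)) *\<^sub>R sph_phi p) $ i)) (at p within A)"
    using exhaust_3[of i]
    by (elim disjE) (auto intro!: derivative_eq_intros simp: algebra_simps)
qed

lemma continuous_on_frame [continuous_intros]:
  fixes f :: "'a::t2_space \<Rightarrow> real \<times> real"
  assumes "continuous_on A f"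
  shows "continuous_on A (\<lambda>x. sph (f x))" "continuous_on A (\<lambda>x. sph_theta (f x))"
    "continuous_on A (\<lambda>x. sph_phi (f x))"
proof -
  have *: "continuous_on A h" if "continuous_on A (\<lambda>x. h x $ 1)" "continuous_on A (\<lambda>x. h x $ 2)"
    "continuous_on A (\<lambda>x. h x $ 3)" for h :: "'a \<Rightarrow> real^3"
  proof -
    have "continuous_on A (\<lambda>x. h x $ i)" for i
      using exhaust_3[of i] that by auto
    then show ?thesis
      using continuous_on_vec_lambda[of A "\<lambda>i x. h x $ i"] by simp
  qed
  show "continuous_on A (\<lambda>x. sph (f x))"
    by (rule *, simp_all, (intro continuous_intros assms)+)
  show "continuous_on A (\<lambda>x. sph_theta (f x))"
    by (rule *, simp_all, (intro continuous_intros assms)+)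
  show "continuous_on A (\<lambda>x. sph_phi (f x))"
    by (rule *, simp_all, (intro continuous_intros assms)+)
qed

abbreviation angles :: "(real \<times> real) set" where
  "angles \<equiv> cbox (0, 0) (pi, 2 * pi)"

lemma continuous_on_comp_sph:
  assumes "continuous_on (sphere 0 1) f"
  shows "continuous_on A (\<lambda>p. f (sph p))"
  by (rule continuous_on_compose2[OF assms]) (auto intro!: continuous_intros)

text \<open>Continuity on the compact angle rectangle turns the iterated Lebesgue integral into a
  single gauge integral over a box, the form in which Fubini and differentiation under the integral
  sign are applied below.\<close>

lemma angular_integral_eq:
  assumes "continuous_on (sphere 0 1) f"
  shows "angular_integral f = integral angles (\<lambda>p. f (sph p) * sin (fst p))"
proof -
  let ?K = "\<lambda>p. f (sph p) * sin (fst p)"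
  have K: "continuous_on A ?K" for A
    by (intro continuous_intros continuous_on_comp_sph assms)
  have inner: "(LINT \<phi>:{0..2*pi}|lborel. f (vector [sin \<theta> * cos \<phi>, sin \<theta> * sin \<phi>, cos \<theta>]) * sin \<theta>)
      = integral {0..2*pi} (\<lambda>\<phi>. ?K (\<theta>, \<phi>))" for \<theta>
  proof -
    have "continuous_on {0..2*pi} (\<lambda>\<phi>. ?K (\<theta>, \<phi>))"
      by (rule continuous_on_compose2[OF K[of UNIV]]) (auto intro!: continuous_intros)
    then have "set_integrable lborel {0..2*pi} (\<lambda>\<phi>. ?K (\<theta>, \<phi>))"
      by (rule borel_integrable_atLeastAtMost')
    from set_borel_integral_eq_integral(2)[OF this] show ?thesis
      by (simp add: sph_def)
  qed
  have "continuous_on {0..pi} (\<lambda>\<theta>. integral (cbox 0 (2*pi)) (\<lambda>\<phi>. ?K (\<theta>, \<phi>)))"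
    by (rule integral_continuous_on_param) (simp add: case_prod_unfold K[unfolded fst_conv])
  then have "set_integrable lborel {0..pi} (\<lambda>\<theta>. integral {0..2*pi} (\<lambda>\<phi>. ?K (\<theta>, \<phi>)))"
    by (intro borel_integrable_atLeastAtMost') (simp add: cbox_interval)
  from set_borel_integral_eq_integral(2)[OF this]
  have "angular_integral f = integral {0..pi} (\<lambda>\<theta>. integral {0..2*pi} (\<lambda>\<phi>. ?K (\<theta>, \<phi>)))"
    by (simp only: angular_integral_def inner)
  also have "\<dots> = integral angles ?K"
    by (subst integral_prod_continuous) (auto simp: K cbox_interval)
  finally show ?thesis .
qed

text \<open>Integrating first in the differentiated variable leaves a difference of boundary values.
  This removes the polar derivative from the divergence; the companion for the second variable
  removes the azimuthal one.\<close>

lemma integral_partial_fst_eq_0: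
  fixes K K' :: "real \<times> real \<Rightarrow> real"
  assumes "a \<le> b" and cont: "continuous_on (cbox (a, c) (b, d)) K'"
    and deriv: "\<And>x y. ((\<lambda>x. K (x, y)) has_real_derivative K' (x, y)) (at x)"
    and eq: "\<And>y. K (a, y) = K (b, y)"
  shows "integral (cbox (a, c) (b, d)) K' = 0"
proof -
  have "integral (cbox a b) (\<lambda>x. K' (x, y)) = 0" for y
  proof -
    have "((\<lambda>x. K' (x, y)) has_integral (K (b, y) - K (a, y))) {a..b}"
      by (rule fundamental_theorem_of_calculus[OF \<open>a \<le> b\<close>])
         (use deriv in \<open>auto simp: has_real_derivative_iff_has_vector_derivative
           intro: has_vector_derivative_at_within\<close>)
    then show ?thesis by (simp add: eq integral_unique cbox_interval)
  qed
  moreover have "integral (cbox (a, c) (b, d)) K'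
      = integral (cbox c d) (\<lambda>y. integral (cbox a b) (\<lambda>x. K' (x, y)))"
    using integral_prod_continuous[OF cont] integral_swap_continuous[of a c b d "\<lambda>x y. K' (x, y)"] cont
    by simp
  ultimately show ?thesis by simp
qed

lemma integral_partial_snd_eq_0:
  fixes K K' :: "real \<times> real \<Rightarrow> real"
  assumes "c \<le> d" and cont: "continuous_on (cbox (a, c) (b, d)) K'"
    and deriv: "\<And>x y. ((\<lambda>y. K (x, y)) has_real_derivative K' (x, y)) (at y)"
    and eq: "\<And>x. K (x, c) = K (x, d)"
  shows "integral (cbox (a, c) (b, d)) K' = 0"
proof -
  have "integral (cbox c d) (\<lambda>y. K' (x, y)) = 0" for x
  proof -
    have "((\<lambda>y. K' (x, y)) has_integral (K (x, d) - K (x, c))) {c..d}"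
      by (rule fundamental_theorem_of_calculus[OF \<open>c \<le> d\<close>])
         (use deriv in \<open>auto simp: has_real_derivative_iff_has_vector_derivative
           intro: has_vector_derivative_at_within\<close>)
    then show ?thesis by (simp add: eq integral_unique cbox_interval)
  qed
  then show ?thesis by (simp add: integral_prod_continuous[OF cont])
qed

section \<open>Continuously differentiable functions and their flux through spheres\<close>

definition C1_on :: "(real^3) set \<Rightarrow> (real^3 \<Rightarrow> real) \<Rightarrow> (real^3 \<Rightarrow> real^3) \<Rightarrow> bool" where
  "C1_on U H g \<longleftrightarrow> (\<forall>x\<in>U. (H has_derivative (\<lambda>v. g x \<bullet> v)) (at x)) \<and> continuous_on U g"

lemma C1_on_continuous: "C1_on U H g \<Longrightarrow> continuous_on U H"
  unfolding C1_on_def by (meson continuous_at_imp_continuous_on has_derivative_continuous)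

text \<open>This is the outward flux through a sphere of the vector field H e_i, whose divergence is
  the i-th partial derivative of \<open>H\<close>. The factor r^2 comes from the surface
  element.\<close>

definition flux :: "3 \<Rightarrow> real^3 \<Rightarrow> (real^3 \<Rightarrow> real) \<Rightarrow> real \<Rightarrow> real" where
  "flux i y H r = r\<^sup>2 * angular_integral (\<lambda>n. n $ i * H (y + r *\<^sub>R n))"

lemma continuous_on_dilate:
  fixes y :: "real^3"
  assumes "continuous_on (- {y}) f" "r > 0"
  shows "continuous_on (sphere 0 1) (\<lambda>n. f (y + r *\<^sub>R n))"
proof (rule continuous_on_compose2[OF assms(1)])
  show "continuous_on (sphere 0 1) (\<lambda>n. y + r *\<^sub>R n)"
    by (intro continuous_intros)
  show "(\<lambda>n. y + r *\<^sub>R n) ` sphere 0 1 \<subseteq> - {y}"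
    using assms(2) by auto
qed

lemma flux_eq:
  assumes "continuous_on (- {y}) H" "r > 0"
  shows "flux i y H r = integral angles (\<lambda>p. r\<^sup>2 * (sph p $ i * H (y + r *\<^sub>R sph p) * sin (fst p)))"
proof -
  have "continuous_on (sphere 0 1) (\<lambda>n. n $ i * H (y + r *\<^sub>R n))"
    by (intro continuous_intros continuous_on_dilate assms)
  from angular_integral_eq[OF this] show ?thesis
    by (simp add: flux_def)
qed

text \<open>The divergence theorem in differential form. Leibniz's rule gives the integral of the
  radial derivative; the full divergence differs from it only by angular derivatives, whose
  integrals vanish.\<close>

lemma flux_has_derivative:
  assumes H: "C1_on (- {y}) H g" and "r > 0"
  shows "(flux i y H has_real_derivative r\<^sup>2 * angular_integral (\<lambda>n. g (y + r *\<^sub>R n) $ i)) (at r)"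
proof -
  define E where "E r p = y + r *\<^sub>R sph p" for r p
  have E_ne: "E r p \<noteq> y" if "r > 0" for r p
    using that norm_sph[of p] by (auto simp: E_def simp del: norm_sph)
  have cH: "continuous_on (- {y}) H" and cg: "continuous_on (- {y}) g"
    using C1_on_continuous[OF H] H by (auto simp: C1_on_def)
  have cE: "continuous_on A (\<lambda>q. E (fst q) (snd q))" "continuous_on B (\<lambda>p. E r p)" for A B r
    unfolding E_def by (intro continuous_intros)+
  have contE: "continuous_on A (\<lambda>q. H (E (fst q) (snd q)))" "continuous_on A (\<lambda>q. g (E (fst q) (snd q)))"
    if "A \<subseteq> {0<..} \<times> UNIV" for A
    using that by (auto intro!: continuous_on_compose2[OF cH cE(1)] continuous_on_compose2[OF cg cE(1)] dest!: E_ne[THEN notE, rotated, OF sym])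
  have contEr: "continuous_on A (\<lambda>p. H (E r p))" "continuous_on A (\<lambda>p. g (E r p))"
    if "r > 0" for A r
    using that by (auto intro!: continuous_on_compose2[OF cH cE(2)] continuous_on_compose2[OF cg cE(2)] dest: E_ne)
  have dH: "(H has_derivative (\<lambda>v. g (E r p) \<bullet> v)) (at (E r p))" if "r > 0" for r p
    using H E_ne[OF that] by (auto simp: C1_on_def)
  define Q where "Q r p = r\<^sup>2 * (sph p $ i * H (E r p) * sin (fst p))" for r p
  define Q' where "Q' r p = 2 * r * (sph p $ i * H (E r p) * sin (fst p))
      + r\<^sup>2 * (sph p $ i * (g (E r p) \<bullet> sph p) * sin (fst p))" for r p
  have dHr: "((\<lambda>r. H (E r p)) has_real_derivative g (E r p) \<bullet> sph p) (at r)" if "r > 0" for r p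
    unfolding has_field_derivative_def
  proof (rule has_derivative_eq_rhs)
    show "((\<lambda>r. H (E r p)) has_derivative (\<lambda>v. g (E r p) \<bullet> v) \<circ> (\<lambda>h. h *\<^sub>R sph p)) (at r)"
      unfolding E_def
      by (rule has_derivative_compose_o[where f = "\<lambda>r. y + r *\<^sub>R sph p" and g = H, OF _ dH[unfolded E_def, OF that]])
         (auto intro!: derivative_eq_intros)
  qed (auto simp: fun_eq_iff)
  have dHp: "((\<lambda>p. H (E r p)) has_derivative
      (\<lambda>h. r * (fst h * (g (E r p) \<bullet> sph_theta p) + snd h * sin (fst p) * (g (E r p) \<bullet> sph_phi p)))) (at p)"
    if "r > 0" for r p
  proof (rule has_derivative_eq_rhs)
    show "((\<lambda>p. H (E r p)) has_derivative (\<lambda>v. g (E r p) \<bullet> v) \<circ> 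
       (\<lambda>h. r *\<^sub>R (fst h *\<^sub>R sph_theta p + (snd h * sin (fst p)) *\<^sub>R sph_phi p))) (at p)"
      unfolding E_def
      by (rule has_derivative_compose_o[where f = "\<lambda>p. y + r *\<^sub>R sph p" and g = H, OF _ dH[unfolded E_def, OF that]])
         (auto intro!: derivative_eq_intros sph_has_derivative)
  qed (auto simp: fun_eq_iff inner_add_right algebra_simps)
  \<comment> \<open>The radius is confined to the positive half-line, where the sphere avoids
    \<open>y\<close> and \<open>H\<close> is differentiable. That set is convex, as Leibniz's rule
    asks, and open, so the derivative is two-sided afterwards.\<close>
  have dQ: "((\<lambda>r. integral angles (Q r)) has_real_derivative integral angles (Q' r)) (at r within {0<..})"
  proof (rule leibniz_rule_field_derivative)
    show "((\<lambda>r. Q r p) has_real_derivative Q' r p) (at r within {0<..})" if "r \<in> {0<..}" for r p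
      unfolding Q_def Q'_def using that
      by (auto intro!: derivative_eq_intros has_field_derivative_at_within[OF dHr] simp: algebra_simps)
    show "Q r integrable_on angles" if "r \<in> {0<..}" for r
      unfolding Q_def using that
      by (intro integrable_continuous continuous_intros contEr) auto
    show "continuous_on ({0<..} \<times> angles) (\<lambda>(r, p). Q' r p)"
      unfolding Q'_def case_prod_unfold
      by (intro continuous_intros contE) auto
  qed (use \<open>r > 0\<close> in auto)
  moreover have "at r within {0<..} = at r"
    by (rule at_within_open) (use \<open>r > 0\<close> in auto)
  ultimately have dQ: "((\<lambda>r. integral angles (Q r)) has_real_derivative integral angles (Q' r)) (at r)"
    by simp
  text \<open>
    Spherical form of the divergence:
    \<open>r\<^sup>2 sin \<theta> \<partial>\<^sub>i H = \<partial>\<^sub>r (r\<^sup>2 sin \<theta> n\<^sup>i H) + r (\<partial>\<^sub>\<theta> (sin \<theta> e\<^sub>\<theta>\<^sup>i H) + \<partial>\<^sub>\<phi> (e\<^sub>\<phi>\<^sup>i H))\<close>.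
    Here \<open>Q\<close>, \<open>T\<close>, \<open>P\<close> are the three quantities being differentiated; \<open>T\<close> vanishes at the poles and
    \<open>P\<close> is periodic in \<open>\<phi>\<close>.
  \<close>
  define T where "T p = sin (fst p) * sph_theta p $ i * H (E r p)" for p
  define T' where "T' p = (cos (fst p) * sph_theta p $ i - sin (fst p) * sph p $ i) * H (E r p)
     + sin (fst p) * sph_theta p $ i * (r * (g (E r p) \<bullet> sph_theta p))" for p
  define P where "P p = sph_phi p $ i * H (E r p)" for p
  define P' where "P' p = - (sin (fst p) * sph p $ i + cos (fst p) * sph_theta p $ i) * H (E r p)
     + sph_phi p $ i * (r * sin (fst p) * (g (E r p) \<bullet> sph_phi p))" for p
  have cT: "continuous_on angles T'" and cP: "continuous_on angles P'"
    unfolding T'_def P'_def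
    by (intro continuous_intros contEr \<open>r > 0\<close>)+
  have "integral angles T' = 0"
  proof (rule integral_partial_fst_eq_0[OF _ cT])
    fix t u
    have 1: "((\<lambda>t. sph_theta (t, u) $ i) has_real_derivative - sph (t, u) $ i) (at t)"
      using exhaust_3[of i] by (elim disjE) (auto intro!: derivative_eq_intros)
    have 2: "((\<lambda>t. H (E r (t, u))) has_real_derivative r * (g (E r (t, u)) \<bullet> sph_theta (t, u))) (at t)"
      unfolding has_field_derivative_def
    proof (rule has_derivative_eq_rhs)
      show "((\<lambda>t. H (E r (t, u))) has_derivative (\<lambda>h. r * (fst h * (g (E r (t,u)) \<bullet> sph_theta (t,u)) 
           + snd h * sin (fst (t,u)) * (g (E r (t,u)) \<bullet> sph_phi (t,u)))) \<circ> (\<lambda>h. (h, 0))) (at t)"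
        by (rule has_derivative_compose_o[where f = "\<lambda>t. (t, u)" and g = "\<lambda>p. H (E r p)", OF _ dHp[OF \<open>r > 0\<close>]])
           (auto intro!: derivative_eq_intros)
    qed (auto simp: fun_eq_iff)
    show "((\<lambda>t. T (t, u)) has_real_derivative T' (t, u)) (at t)"
      unfolding T_def T'_def using 1 2
      by (auto intro!: derivative_eq_intros simp: algebra_simps)
  qed (auto simp: T_def)
  moreover have "integral angles P' = 0"
  proof (rule integral_partial_snd_eq_0[OF _ cP])
    fix t u :: real
    have S: "(sin t)\<^sup>2 = 1 - (cos t)\<^sup>2"
      by (rule sin_squared_eq)
    \<comment> \<open>The azimuthal derivative of e_phi is minus the horizontal outward direction.
      Writing that direction in the frame lets it combine with the terms of
      \<open>T'\<close>.\<close>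
    have 1: "((\<lambda>u. sph_phi (t, u) $ i) has_real_derivative
        - (sin t * sph (t, u) $ i + cos t * sph_theta (t, u) $ i)) (at u)"
      using exhaust_3[of i]
    proof (elim disjE)
      assume i: "i = 1"
      have "sin t * sph (t, u) $ i + cos t * sph_theta (t, u) $ i = cos u"
        unfolding i sph_nth fst_conv snd_conv using S by algebra
      then show ?thesis unfolding i by (auto intro!: derivative_eq_intros)
    next
      assume i: "i = 2"
      have "sin t * sph (t, u) $ i + cos t * sph_theta (t, u) $ i = sin u"
        unfolding i sph_nth fst_conv snd_conv using S by algebra
      then show ?thesis unfolding i by (auto intro!: derivative_eq_intros)
    qed (auto intro!: derivative_eq_intros)
    have 2: "((\<lambda>u. H (E r (t, u))) has_real_derivative r * sin t * (g (E r (t, u)) \<bullet> sph_phi (t, u))) (at u)"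
      unfolding has_field_derivative_def
    proof (rule has_derivative_eq_rhs)
      show "((\<lambda>u. H (E r (t, u))) has_derivative (\<lambda>h. r * (fst h * (g (E r (t,u)) \<bullet> sph_theta (t,u)) 
           + snd h * sin (fst (t,u)) * (g (E r (t,u)) \<bullet> sph_phi (t,u)))) \<circ> (\<lambda>h. (0, h))) (at u)"
        by (rule has_derivative_compose_o[where f = "\<lambda>u. (t, u)" and g = "\<lambda>p. H (E r p)", OF _ dHp[OF \<open>r > 0\<close>]])
           (auto intro!: derivative_eq_intros)
    qed (auto simp: fun_eq_iff)
    show "((\<lambda>u. P (t, u)) has_real_derivative P' (t, u)) (at u)"
      unfolding P_def P'_def using 1 2
      by (auto intro!: derivative_eq_intros simp: algebra_simps)
  next
    show "P (t, 0) = P (t, 2 * pi)" for t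
    proof -
      have "sph (t, 0) = sph (t, 2 * pi)" "sph_phi (t, 0) = sph_phi (t, 2 * pi)"
        by (simp_all add: sph_def sph_phi_def)
      then show ?thesis by (simp add: P_def E_def)
    qed
  qed auto
  \<comment> \<open>The terms with undifferentiated \<open>H\<close> cancel: \<open>T'\<close> and
    \<open>P'\<close> together contribute -2 r sin theta n^i H, against +2 r sin theta n^i H from
    differentiating r^2. The gradient terms are the frame expansion.\<close>
  moreover have "r\<^sup>2 * (g (E r p) $ i * sin (fst p)) = Q' r p + r * (T' p + P' p)" for p
    unfolding Q'_def T'_def P'_def frame_expansion[of p i "g (E r p)", symmetric]
    by (simp add: algebra_simps power2_eq_square)
  moreover have "continuous_on angles (Q' r)"
    unfolding Q'_def by (intro continuous_intros contEr \<open>r > 0\<close>)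
  ultimately have "integral angles (\<lambda>p. r\<^sup>2 * (g (E r p) $ i * sin (fst p))) = integral angles (Q' r)"
    using cT cP by (simp add: integral_add integrable_continuous continuous_on_add continuous_on_mult_left)
  moreover have "angular_integral (\<lambda>n. g (y + r *\<^sub>R n) $ i) = integral angles (\<lambda>p. g (E r p) $ i * sin (fst p))"
    unfolding E_def
    by (rule angular_integral_eq) (intro continuous_intros continuous_on_dilate cg \<open>r > 0\<close>)
  ultimately have *: "integral angles (Q' r) = r\<^sup>2 * angular_integral (\<lambda>n. g (y + r *\<^sub>R n) $ i)"
    by simp
  have "\<forall>\<^sub>F s in nhds r. s > 0"
    using eventually_nhds_in_open[of "{0<..}" r] \<open>r > 0\<close> by simp
  then have "\<forall>\<^sub>F s in nhds r. flux i y H s = integral angles (Q s)"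
    by eventually_elim (simp add: flux_eq[OF cH] Q_def[abs_def] E_def)
  from DERIV_cong_ev[OF refl this refl] dQ * show ?thesis
    by (simp add: DERIV_cong_ev)
qed

subsection \<open>Volume integrals over spherical shells\<close>

lemma cart3_eq_iff: "x = y \<longleftrightarrow> x $ 1 = y $ 1 \<and> x $ 2 = y $ 2 \<and> x $ 3 = y $ 3" for x y :: "'a^3"
  by (simp add: vec_eq_iff forall_3)

text \<open>The open ranges exclude the poles and the seam of the azimuth, where angles are
  ambiguous. The cosine determines theta; dividing by sin theta > 0 then determines phi modulo 2
  pi.\<close>

lemma sph_eq_imp_eq:
  assumes "sph (t, u) = sph (t', u')" "t \<in> {0<..<pi}" "t' \<in> {0<..<pi}"
    "u \<in> {0<..<2*pi}" "u' \<in> {0<..<2*pi}"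
  shows "t = t' \<and> u = u'"
proof
  have *: "sin t * cos u = sin t' * cos u'" "sin t * sin u = sin t' * sin u'" "cos t = cos t'"
    using assms(1) by (simp_all add: cart3_eq_iff)
  then show t: "t = t'"
    using cos_inj_pi[of t t'] assms by auto
  have "sin t > 0"
    using assms sin_gt_zero by auto
  then have "sin u = sin u' \<and> cos u = cos u'"
    using * t by auto
  then obtain n :: int where n: "u = u' + 2 * pi * n"
    using sin_cos_eq_iff by blast
  then have "\<bar>2 * pi * n\<bar> < 2 * pi * 1"
    using assms(4,5) by auto
  then have "\<bar>real_of_int n\<bar> < 1"
    by (simp add: abs_mult)
  then have "n = 0" by linarith
  then show "u = u'" using n by simp
qed

text \<open>Leaving out one coordinate plane avoids both the polar axis and the seam phi = 0, which
  lie in it. The plane is negligible, so nothing is lost under an integral.\<close>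

lemma sph_coordinates:
  fixes v :: "real^3"
  assumes "v $ 2 \<noteq> 0"
  obtains t u where "t \<in> {0<..<pi}" "u \<in> {0<..<2*pi}" "v = norm v *\<^sub>R sph (t, u)"
proof -
  define r where "r = norm v"
  define \<rho> where "\<rho> = sqrt ((v$1)\<^sup>2 + (v$2)\<^sup>2)"
  have "(v$1)\<^sup>2 + (v$2)\<^sup>2 > 0" using assms by (simp add: sum_power2_gt_zero_iff)
  then have \<rho>: "\<rho> > 0" "\<rho>\<^sup>2 = (v$1)\<^sup>2 + (v$2)\<^sup>2"
    unfolding \<rho>_def by simp_all
  have "v \<noteq> 0" using assms by auto
  then have r: "r > 0" "r\<^sup>2 = \<rho>\<^sup>2 + (v$3)\<^sup>2"
    using \<rho>(2) power2_norm_eq_inner[of v]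
    by (simp_all add: r_def inner_vec_def sum_3 power2_eq_square)
  have "(v$3 / r)\<^sup>2 + (\<rho> / r)\<^sup>2 = (\<rho>\<^sup>2 + (v$3)\<^sup>2) / r\<^sup>2"
    by (simp add: power_divide add_divide_distrib)
  then have "(v$3 / r)\<^sup>2 + (\<rho> / r)\<^sup>2 = 1"
    using r(1) by (simp add: r(2)[symmetric])
  then obtain t where t: "0 \<le> t" "t \<le> pi" "v$3 / r = cos t" "\<rho> / r = sin t"
    using sincos_total_pi[of "\<rho> / r" "v$3 / r"] r \<rho> by auto
  have "(v$1 / \<rho>)\<^sup>2 + (v$2 / \<rho>)\<^sup>2 = 1"
    using \<rho>(1) by (simp add: power_divide add_divide_distrib[symmetric] \<rho>(2)[symmetric])
  then obtain u where u: "0 \<le> u" "u < 2 * pi" "v$1 / \<rho> = cos u" "v$2 / \<rho> = sin u"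
    using sincos_total_2pi by metis
  have "sin t \<noteq> 0" "sin u \<noteq> 0" using t u \<rho> r assms by auto
  then have "t \<noteq> 0" "t \<noteq> pi" "u \<noteq> 0" by auto
  moreover have "v = r *\<^sub>R sph (t, u)"
    using t(3,4)[symmetric] u(3,4)[symmetric] r(1) \<rho>(1) by (simp add: cart3_eq_iff)
  ultimately show ?thesis
    using that[of t u] t u by (auto simp: r_def)
qed

lemma prod_UNIV_3: "(\<Prod>i\<in>(UNIV :: 3 set). f i) = f 1 * (f 2 * f 3)"
  unfolding UNIV_3 by simp

text \<open>Fubini for nested pairs, transported along the coordinate bijection between vectors and
  triples. That bijection maps boxes to boxes of equal content, hence preserves integrals.\<close>

lemma integral_cart3_cbox:
  fixes K :: "real^3 \<Rightarrow> real"
  assumes K: "continuous_on (cbox l u) K"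
  shows "integral (cbox l u) K = integral {l$1..u$1} (\<lambda>r. integral (cbox (l$2, l$3) (u$2, u$3))
           (\<lambda>p. K (vector [r, fst p, snd p])))"
proof -
  define h :: "real^3 \<Rightarrow> real \<times> real \<times> real" where "h v = (v$1, v$2, v$3)" for v
  define g :: "real \<times> real \<times> real \<Rightarrow> real^3" where "g q = vector [fst q, fst (snd q), snd (snd q)]" for q
  have hg: "h (g q) = q" and gh: "g (h v) = v" for q v
    by (auto simp: h_def g_def cart3_eq_iff)
  have box: "x \<in> cbox l u \<longleftrightarrow> l$1 \<le> x$1 \<and> x$1 \<le> u$1 \<and> l$2 \<le> x$2 \<and> x$2 \<le> u$2 \<and> l$3 \<le> x$3 \<and> x$3 \<le> u$3"
    for x l u :: "real^3"
    by (auto simp: mem_box_cart forall_3)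
  have himg: "h ` cbox l u = cbox (h l) (h u)" for l u
  proof
    show "h ` cbox l u \<subseteq> cbox (h l) (h u)"
      by (auto simp: box h_def)
    show "cbox (h l) (h u) \<subseteq> h ` cbox l u"
    proof
      fix q assume "q \<in> cbox (h l) (h u)"
      then have "g q \<in> cbox l u" by (auto simp: box h_def g_def cbox_Pair_eq)
      then show "q \<in> h ` cbox l u" using hg by (metis imageI)
    qed
  qed
  have gimg: "g ` cbox l u = cbox (g l) (g u)" for l u
  proof -
    have "g ` cbox l u = g ` (h ` cbox (g l) (g u))"
      by (simp add: himg hg)
    then show ?thesis by (simp add: image_image gh)
  qed
  have contg: "continuous_on A g" for A
  proof -
    have "continuous_on A (\<lambda>q. g q $ i)" for i
      using exhaust_3[of i] unfolding g_def
      by (elim disjE) (auto intro!: continuous_intros)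
    then show ?thesis
      using continuous_on_vec_lambda[of A "\<lambda>i q. g q $ i"] by simp
  qed
  have content: "measure lborel (g ` cbox l u) = 1 * measure lborel (cbox l u)" for l u
  proof -
    obtain l1 l2 l3 u1 u2 u3 where lu: "l = (l1, l2, l3)" "u = (u1, u2, u3)" by (metis prod_cases3)
    have ne: "cbox (g l) (g u) \<noteq> {} \<longleftrightarrow> l1 \<le> u1 \<and> l2 \<le> u2 \<and> l3 \<le> u3"
      by (auto simp: interval_eq_empty_cart forall_3 g_def lu not_less)
    show ?thesis
    proof (cases "l1 \<le> u1 \<and> l2 \<le> u2 \<and> l3 \<le> u3")
      case True
      then have "cbox (g l) (g u) \<noteq> {}" using ne by blast
      then have "measure lborel (cbox (g l) (g u)) = (u1 - l1) * ((u2 - l2) * (u3 - l3))"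
        by (subst content_cbox_cart) (simp_all add: prod_UNIV_3 g_def lu)
      also have "\<dots> = measure lborel (cbox l u)"
        using True by (simp only: lu content_Pair) (simp add: cbox_interval)
      finally show ?thesis by (simp only: gimg mult_1)
    next
      case False
      then have "cbox (g l) (g u) = {}" using ne by blast
      moreover from this have "cbox l u = {}" using gimg[of l u] by blast
      ultimately show ?thesis by simp
    qed
  qed
  have "((\<lambda>q. K (g q)) has_integral (1 / 1) *\<^sub>R integral (cbox l u) K) (h ` cbox l u)"
  proof (rule has_integral_twiddle[where g = g and h = h and r = 1])
    show "continuous (at x) g" for x
      using contg[of UNIV] unfolding continuous_on_eq_continuous_at[OF open_UNIV] by blast
    show "(K has_integral integral (cbox l u) K) (cbox l u)"
      using K by (simp add: integrable_continuous integrable_integral)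
    show "\<exists>w z. g ` cbox u v = cbox w z" for u v
      using gimg by blast
    show "\<exists>w z. h ` cbox u v = cbox w z" for u v
      using himg by blast
  qed (use hg gh content in \<open>simp_all\<close>)
  then have "integral (cbox l u) K = integral (cbox (h l) (h u)) (\<lambda>q. K (g q))"
    by (simp add: himg integral_unique)
  also have "\<dots> = integral (cbox (l$1) (u$1)) (\<lambda>r. integral (cbox (l$2, l$3) (u$2, u$3)) (\<lambda>p. K (g (r, p))))"
    unfolding h_def
  proof (rule integral_prod_continuous)
    have "g ` cbox (h l) (h u) = cbox l u" by (simp add: gimg gh)
    then show "continuous_on (cbox (l$1, l$2, l$3) (u$1, u$2, u$3)) (\<lambda>q. K (g q))"
      unfolding h_def by (intro continuous_on_compose2[OF K contg]) auto
  qed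
  finally show ?thesis by (simp add: g_def cbox_interval)
qed

lemma negligible_coordinate_hyperplane: "negligible {x::real^'n. x$k = c}"
proof -
  have "axis k 1 \<in> (Basis :: (real^'n) set)" by simp
  from negligible_standard_hyperplane[OF this] show ?thesis
    by (simp add: cart_eq_inner_axis)
qed

lemma integral_vec1_nth:
  fixes f :: "'a::euclidean_space \<Rightarrow> real^1"
  assumes "f absolutely_integrable_on S"
  shows "integral S f $ 1 = integral S (\<lambda>x. f x $ 1)"
  using integral_linear[OF set_lebesgue_integral_eq_integral(1)[OF assms] bounded_linear_vec_nth[of 1]]
  by (simp add: o_def)

section \<open>Spherical coordinates on a shell and the divergence theorem\<close>

abbreviation shell :: "real^3 \<Rightarrow> real \<Rightarrow> real \<Rightarrow> (real^3) set" where
  "shell y a b \<equiv> {x. a \<le> norm (x - y) \<and> norm (x - y) \<le> b}"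

text \<open>Change of variables (r, theta, phi) with Jacobian r^2 sin theta, followed by Fubini. The
  lower radius is positive, so the integrand is continuous on the whole closed parameter
  box.\<close>

lemma integral_shell:
  fixes f :: "real^3 \<Rightarrow> real"
  assumes f: "continuous_on (- {y}) f" and a: "0 < a"
  shows "integral (shell y a b) f = integral {a..b} (\<lambda>r. r\<^sup>2 * angular_integral (\<lambda>n. f (y + r *\<^sub>R n)))"
proof -
  define g :: "real^3 \<Rightarrow> real^3" where "g p = y + p$1 *\<^sub>R sph (p$2, p$3)" for p
  define g' :: "real^3 \<Rightarrow> real^3 \<Rightarrow> real^3" where
    "g' p h = h$1 *\<^sub>R sph (p$2, p$3) + p$1 *\<^sub>R (h$2 *\<^sub>R sph_theta (p$2, p$3)
        + (h$3 * sin (p$2)) *\<^sub>R sph_phi (p$2, p$3))" for p h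
  \<comment> \<open>Two parameter domains: \<open>S\<close> has open angle ranges, which makes
    \<open>g\<close> injective, while \<open>C\<close> is the closed box on which continuity gives
    integrability. They differ by a negligible set.\<close>
  define S :: "(real^3) set" where
    "S = {p. a \<le> p$1 \<and> p$1 \<le> b} \<inter> {p. 0 < p$2 \<and> p$2 < pi \<and> 0 < p$3 \<and> p$3 < 2 * pi}"
  define C :: "(real^3) set" where "C = cbox (vector [a, 0, 0]) (vector [b, pi, 2 * pi])"
  have C: "C = {p. a \<le> p$1 \<and> p$1 \<le> b \<and> 0 \<le> p$2 \<and> p$2 \<le> pi \<and> 0 \<le> p$3 \<and> p$3 \<le> 2 * pi}"
    by (auto simp: C_def mem_box_cart forall_3)
  define D where "D p = (p$1)\<^sup>2 * (f (g p) * sin (p$2))" for p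
  have "closed {p::real^3. a \<le> p$1 \<and> p$1 \<le> b}"
    by (intro closed_Collect_conj closed_Collect_le continuous_intros)
  moreover have "open {p::real^3. 0 < p$2 \<and> p$2 < pi \<and> 0 < p$3 \<and> p$3 < 2 * pi}"
    by (intro open_Collect_conj open_Collect_less continuous_intros)
  ultimately have S: "S \<in> sets lebesgue"
    unfolding S_def by (auto intro!: sets.Int)
  have norm_g: "norm (g p - y) = \<bar>p$1\<bar>" for p by (simp add: g_def)
  have dg: "(g has_derivative g' p) (at p within S)" for p
  proof -
    have "((\<lambda>p. (p$2, p$3)) has_derivative (\<lambda>h. (h$2, h$3))) (at p within S)"
      by (intro has_derivative_Pair bounded_linear_imp_has_derivative bounded_linear_vec_nth)
    from has_derivative_in_compose[OF this sph_has_derivative[of _ "(\<lambda>p. (p$2, p$3)) ` S"]]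
    have "((\<lambda>p. sph (p$2, p$3)) has_derivative
      (\<lambda>h. h$2 *\<^sub>R sph_theta (p$2, p$3) + (h$3 * sin (p$2)) *\<^sub>R sph_phi (p$2, p$3))) (at p within S)"
      by simp
    then show ?thesis
      unfolding g_def g'_def
      by (auto intro!: derivative_eq_intros bounded_linear_imp_has_derivative[OF bounded_linear_vec_nth])
  qed
  have inj: "inj_on g S"
  proof
    fix p q assume pq: "p \<in> S" "q \<in> S" "g p = g q"
    then have 1: "p$1 = q$1"
      using norm_g[of p] norm_g[of q] a by (auto simp: S_def)
    then have "sph (p$2, p$3) = sph (q$2, q$3)"
      using pq a by (auto simp: g_def S_def)
    from sph_eq_imp_eq[OF this] pq 1 show "p = q"
      by (auto simp: S_def cart3_eq_iff)
  qed
  have det: "det (matrix (g' p)) = (p$1)\<^sup>2 * sin (p$2)" for p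
  proof -
    have sq: "(sin (p$2))\<^sup>2 = 1 - (cos (p$2))\<^sup>2" "(sin (p$3))\<^sup>2 = 1 - (cos (p$3))\<^sup>2"
      by (auto simp: sin_squared_eq)
    show ?thesis
      by (simp add: det_3 matrix_def g'_def axis_def) (use sq in algebra)
  qed
  have contg: "continuous_on A g" for A
    unfolding g_def by (intro continuous_intros)
  have cont_f: "continuous_on C (\<lambda>p. f (g p))"
  proof (rule continuous_on_compose2[OF f contg])
    show "g ` C \<subseteq> - {y}"
    proof (rule image_subsetI)
      fix p assume "p \<in> C"
      then show "g p \<in> - {y}" using a norm_g[of p] by (auto simp: C)
    qed
  qed
  then have contD: "continuous_on C D"
    unfolding D_def by (intro continuous_intros)
  \<comment> \<open>the change of variables theorem requires an integrand with values in some \<open>real^'n\<close>\<close>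
  let ?v = "\<lambda>x. vec (f x) :: real^1"
  have negS: "negligible (C - S)"
  proof (rule negligible_subset)
    show "C - S \<subseteq> {p. p$2 = 0} \<union> {p. p$2 = pi} \<union> {p. p$3 = 0} \<union> {p. p$3 = 2*pi}"
      by (auto simp: C S_def)
    show "negligible ({p. p$2 = 0} \<union> {p::real^3. p$2 = pi} \<union> {p. p$3 = 0} \<union> {p. p$3 = 2*pi})"
      by (intro negligible_Un negligible_coordinate_hyperplane)
  qed
  have SC: "S \<subseteq> C" by (auto simp: C S_def)
  have absS: "\<bar>det (matrix (g' p))\<bar> *\<^sub>R ?v (g p) = vec (D p)" if "p \<in> S" for p
  proof -
    have "sin (p$2) \<ge> 0" using that by (auto simp: S_def intro!: sin_ge_zero)
    then show ?thesis by (simp add: det D_def abs_mult vec_eq_iff)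
  qed
  have "(\<lambda>p. vec (D p) :: real^1) absolutely_integrable_on C"
    unfolding C_def
  proof (rule absolutely_integrable_continuous)
    show "continuous_on (cbox (vector [a, 0, 0]) (vector [b, pi, 2 * pi])) (\<lambda>p. vec (D p) :: real^1)"
      using contD unfolding vec_def C_def by (intro continuous_on_vec_lambda)
  qed
  then have intD: "(\<lambda>p. vec (D p) :: real^1) absolutely_integrable_on S"
    by (rule set_integrable_subset[OF _ S SC])
  then have 1: "(\<lambda>p. \<bar>det (matrix (g' p))\<bar> *\<^sub>R ?v (g p)) absolutely_integrable_on S"
    by (rule set_integrable_cong[THEN iffD1, rotated -1]) (use absS in auto)
  have "integral (g ` S) ?v = integral S (\<lambda>p. \<bar>det (matrix (g' p))\<bar> *\<^sub>R ?v (g p))"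
    by (rule integral_change_of_variables[OF S dg inj]) (use 1 in auto)
  also have "\<dots> = integral S (\<lambda>p. vec (D p))"
    by (rule integral_cong) (rule absS)
  finally have eqv: "integral (g ` S) ?v = integral S (\<lambda>p. vec (D p) :: real^1)" .
  have int_v: "?v absolutely_integrable_on (g ` S)"
    using has_absolute_integral_change_of_variables[OF S dg inj, of ?v] 1 by blast
  have "integral (g ` S) f = integral (g ` S) (\<lambda>x. ?v x $ 1)" by simp
  also have "\<dots> = integral (g ` S) ?v $ 1"
    by (rule integral_vec1_nth[OF int_v, symmetric])
  also have "\<dots> = integral S (\<lambda>p. (vec (D p) :: real^1) $ 1)"
    unfolding eqv
    by (rule integral_vec1_nth) (rule intD)
  also have "\<dots> = integral S D" by simp
  also have "\<dots> = integral C D"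
    by (rule integral_spike_set) (use negS SC in \<open>auto intro: negligible_subset\<close>)
  also have "\<dots> = integral {a..b} (\<lambda>r. integral angles (\<lambda>p. D (vector [r, fst p, snd p])))"
    using integral_cart3_cbox[of "vector [a, 0, 0]" "vector [b, pi, 2 * pi]" D] contD unfolding C_def by simp
  also have "\<dots> = integral {a..b} (\<lambda>r. r\<^sup>2 * angular_integral (\<lambda>n. f (y + r *\<^sub>R n)))"
  proof (rule integral_cong)
    fix r assume "r \<in> {a..b}"
    then have "r > 0" using a by auto
    from angular_integral_eq[OF continuous_on_dilate[OF f this]]
    show "integral angles (\<lambda>p. D (vector [r, fst p, snd p])) = r\<^sup>2 * angular_integral (\<lambda>n. f (y + r *\<^sub>R n))"
      by (simp add: D_def g_def)
  qed
  finally have "integral (g ` S) f = integral {a..b} (\<lambda>r. r\<^sup>2 * angular_integral (\<lambda>n. f (y + r *\<^sub>R n)))" .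
  \<comment> \<open>The image of \<open>S\<close> is the shell up to points of the plane through
    \<open>y\<close> that \<open>sph_coordinates\<close> leaves out.\<close>
  moreover have "integral (shell y a b) f = integral (g ` S) f"
  proof (rule integral_spike_set)
    have "g ` S \<subseteq> shell y a b" using a by (auto simp: norm_g S_def)
    then have "{x \<in> g ` S - shell y a b. f x \<noteq> 0} = {}" by blast
    then show "negligible {x \<in> g ` S - shell y a b. f x \<noteq> 0}" by (metis negligible_empty)
    show "negligible {x \<in> shell y a b - g ` S. f x \<noteq> 0}"
    proof (rule negligible_subset[OF negligible_coordinate_hyperplane])
      show "{x \<in> shell y a b - g ` S. f x \<noteq> 0} \<subseteq> {x. x$2 = y$2}"
      proof safe
        fix x assume x: "a \<le> norm (x - y)" "norm (x - y) \<le> b" "x \<notin> g ` S"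
        show "x$2 = y$2"
        proof (rule ccontr)
          assume "x$2 \<noteq> y$2"
          then have "(x - y)$2 \<noteq> 0" by simp
          from sph_coordinates[OF this] obtain t u where
            tu: "t \<in> {0<..<pi}" "u \<in> {0<..<2*pi}" "x - y = norm (x - y) *\<^sub>R sph (t, u)" by metis
          then have "x = g (vector [norm (x - y), t, u])"
            by (simp add: g_def algebra_simps)
          moreover have "vector [norm (x - y), t, u] \<in> S"
            using x tu by (simp add: S_def)
          ultimately show False using x(3) by blast
        qed
      qed
    qed
  qed
  ultimately show ?thesis by simp
qed

text \<open>The divergence theorem on a shell: the fundamental theorem of calculus applied to the
  flux as a function of the radius.\<close>

lemma integral_shell_gradient:
  assumes H: "C1_on (- {y}) H g" and "0 < a" "a \<le> b"
  shows "integral (shell y a b) (\<lambda>x. g x $ i) = flux i y H b - flux i y H a"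
proof -
  have "continuous_on (- {y}) (\<lambda>x. g x $ i)"
    using H by (auto simp: C1_on_def intro!: continuous_intros)
  from integral_shell[OF this \<open>0 < a\<close>]
  have "integral (shell y a b) (\<lambda>x. g x $ i)
      = integral {a..b} (\<lambda>r. r\<^sup>2 * angular_integral (\<lambda>n. g (y + r *\<^sub>R n) $ i))" .
  also have "\<dots> = flux i y H b - flux i y H a"
  proof (rule integral_unique, rule fundamental_theorem_of_calculus[OF \<open>a \<le> b\<close>])
    fix r assume "r \<in> {a..b}"
    then have "r > 0" using \<open>0 < a\<close> by auto
    from flux_has_derivative[OF H this, of i]
    show "(flux i y H has_vector_derivative r\<^sup>2 * angular_integral (\<lambda>n. g (y + r *\<^sub>R n) $ i)) (at r within {a..b})"
      by (simp add: has_real_derivative_iff_has_vector_derivative has_vector_derivative_at_within)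
  qed
  finally show ?thesis .
qed

subsection \<open>Angular integrals and uniqueness of expansions\<close>

lemma angular_integral_cong:
  assumes "\<And>n. n \<in> sphere 0 1 \<Longrightarrow> f n = g n"
  shows "angular_integral f = angular_integral g"
proof -
  have "vector [sin t * cos u, sin t * sin u, cos t] \<in> sphere (0::real^3) 1" for t u
    using norm_sph[of "(t, u)"] by (simp add: sph_def)
  then show ?thesis
    by (simp add: angular_integral_def assms)
qed

lemma integrable_angles:
  "continuous_on (sphere 0 1) f \<Longrightarrow> (\<lambda>p. f (sph p) * sin (fst p)) integrable_on angles"
  by (intro integrable_continuous continuous_intros continuous_on_comp_sph)

lemma angular_integral_0 [simp]: "angular_integral (\<lambda>n. 0) = 0"
  by (simp add: angular_integral_def)

lemma angular_integral_add:
  assumes "continuous_on (sphere 0 1) f" "continuous_on (sphere 0 1) g"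
  shows "angular_integral (\<lambda>n. f n + g n) = angular_integral f + angular_integral g"
  using assms
  by (simp add: angular_integral_eq continuous_on_add distrib_right integral_add integrable_angles)

lemma angular_integral_cmult:
  assumes "continuous_on (sphere 0 1) f"
  shows "angular_integral (\<lambda>n. k * f n) = k * angular_integral f"
  using assms by (simp add: angular_integral_eq continuous_on_mult_left mult.assoc)

lemma angular_integral_sum:
  assumes "\<And>i. i \<in> I \<Longrightarrow> continuous_on (sphere 0 1) (f i)"
  shows "angular_integral (\<lambda>n. \<Sum>i\<in>I. f i n) = (\<Sum>i\<in>I. angular_integral (f i))"
  using assms
proof (induction I rule: infinite_finite_induct)
  case (insert i I)
  then show ?case by (simp add: angular_integral_add continuous_on_sum)
qed auto

text \<open>The constant is the area pi * 2 pi of the angle rectangle, with sin theta bounded by 1.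
  It is cruder than 4 pi but suffices for estimates that tend to 0.\<close>

lemma angular_integral_bound:
  assumes f: "continuous_on (sphere 0 1) f" and M: "\<And>n. n \<in> sphere 0 1 \<Longrightarrow> \<bar>f n\<bar> \<le> M"
  shows "\<bar>angular_integral f\<bar> \<le> 2 * pi\<^sup>2 * M"
proof -
  have "0 \<le> M" using M[of "sph (0, 0)"] by auto
  have "norm (integral angles (\<lambda>p. f (sph p) * sin (fst p))) \<le> M * measure lborel angles"
  proof (rule has_integral_bound[OF \<open>0 \<le> M\<close> integrable_integral[OF integrable_angles[OF f]]])
    fix p
    have "\<bar>f (sph p)\<bar> * \<bar>sin (fst p)\<bar> \<le> M * 1"
      using \<open>0 \<le> M\<close> by (intro mult_mono M) auto
    then show "norm (f (sph p) * sin (fst p)) \<le> M" by (simp add: abs_mult)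
  qed
  also have "measure lborel angles = 2 * pi\<^sup>2"
    by (simp add: content_Pair power2_eq_square)
  finally show ?thesis
    by (simp add: angular_integral_eq[OF f] mult.commute)
qed

section \<open>Radial terms, approach along rays, uniqueness of coefficients\<close>

lemma radial_term_sphere:
  assumes "r > 0" "norm n = 1"
  shows "radial_term y a f (y + r *\<^sub>R n) = r powr a * f n"
  using assms by (simp add: radial_term_def unit_dir_def)

lemma norm_unit_dir [simp]: "x \<noteq> y \<Longrightarrow> norm (unit_dir y x) = 1"
  by (simp add: unit_dir_def)

lemma polar_decomp: "x \<noteq> y \<Longrightarrow> x = y + norm (x - y) *\<^sub>R unit_dir y x"
  by (simp add: unit_dir_def)

lemma filterlim_ray:
  fixes y n :: "real^3"
  assumes "norm n = 1"
  shows "filterlim (\<lambda>t. y + t *\<^sub>R n) (at y) (at_right 0)"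
  unfolding filterlim_at
proof
  have "n \<noteq> 0" using assms by auto
  then show "\<forall>\<^sub>F t in at_right 0. y + t *\<^sub>R n \<in> UNIV \<and> y + t *\<^sub>R n \<noteq> y"
    by (intro eventually_mono[OF eventually_at_right_less[of 0]]) auto
  have "((\<lambda>t. y + t *\<^sub>R n) \<longlongrightarrow> y + 0 *\<^sub>R n) (at_right 0)"
    by (intro tendsto_intros)
  then show "((\<lambda>t. y + t *\<^sub>R n) \<longlongrightarrow> y) (at_right 0)" by simp
qed

lemma powr_tendsto_0_at_right: "p > 0 \<Longrightarrow> ((\<lambda>t::real. t powr p) \<longlongrightarrow> 0) (at_right 0)"
  by (rule tendsto_zero_powrI[OF tendsto_ident_at tendsto_const])
     (auto intro: eventually_mono[OF eventually_at_right_less[of 0]])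

lemma expansion_at_remainder:
  "expansion_at y F A c \<Longrightarrow>
    (\<lambda>x. F x - (\<Sum>a | a \<in> A \<and> a \<le> real N. radial_term y a (c a) x)) \<in> o[at y](\<lambda>x. norm (x - y) ^ N)"
  unfolding expansion_at_def by blast

text \<open>Fix the direction \<open>n\<close> and take the least exponent \<open>m\<close> at which
  the two coefficients differ there; it exists because only finitely many exponents lie below a
  bound. Along the ray, the difference of the two truncated sums divided by t^m tends to a nonzero
  constant, yet it must tend to 0.\<close>

lemma expansion_at_coeff_unique:
  assumes c: "expansion_at y F A c" and d: "expansion_at y F B d"
  shows "c a n = d a n"
proof (rule ccontr)
  assume ne: "c a n \<noteq> d a n"
  have fin: "finite {e \<in> A \<union> B. e \<le> M}" for M
  proof -
    have "{e \<in> A \<union> B. e \<le> M} = {e \<in> A. e \<le> M} \<union> {e \<in> B. e \<le> M}" by auto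
    then show ?thesis using c d by (simp add: expansion_at_def)
  qed
  have zero: "c e n = 0" if "e \<notin> A" for e using c that by (simp add: expansion_at_def)
  have zero': "d e n = 0" if "e \<notin> B" for e using d that by (simp add: expansion_at_def)
  have n: "norm n = 1" and a: "a \<in> A \<union> B"
    using ne c d by (auto simp: expansion_at_def) metis+
  define X where "X = {e \<in> A \<union> B. e \<le> a \<and> c e n \<noteq> d e n}"
  have X: "finite X" "X \<noteq> {}"
    using a ne by (auto simp: X_def intro: finite_subset[OF _ fin[of a]])
  define m where "m = Min X"
  have m: "m \<in> A \<union> B" "m \<le> a" "c m n \<noteq> d m n"
    using Min_in[OF X] by (auto simp: m_def X_def)
  have below: "c e n = d e n" if "e < m" for e
  proof (rule ccontr)
    assume "c e n \<noteq> d e n"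
    moreover have "e \<in> A \<union> B" using calculation zero[of e] zero'[of e] by fastforce
    ultimately have "e \<in> X" using that m by (auto simp: X_def)
    then have "m \<le> e" unfolding m_def using Min_le[OF X(1)] by blast
    then show False using that by simp
  qed
  \<comment> \<open>Since m <= a, the truncation order exceeds \<open>m\<close> by at least 1, so a
    remainder o(t^N) still vanishes after division by t^m.\<close>
  obtain N :: nat where N: "a + 1 \<le> real N" using real_arch_simple by blast
  define I where "I = {e \<in> A \<union> B. e \<le> real N}"
  have I: "finite I" unfolding I_def by (rule fin)
  have "(\<lambda>x. (\<Sum>e | e \<in> A \<and> e \<le> real N. radial_term y e (c e) x) - (\<Sum>e | e \<in> B \<and> e \<le> real N. radial_term y e (d e) x))
     \<in> o[at y](\<lambda>x. norm (x - y) ^ N)" (is "?D \<in> _")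
  proof -
    have "(\<lambda>x. (F x - (\<Sum>e | e \<in> B \<and> e \<le> real N. radial_term y e (d e) x))
         - (F x - (\<Sum>e | e \<in> A \<and> e \<le> real N. radial_term y e (c e) x))) \<in> o[at y](\<lambda>x. norm (x - y) ^ N)"
      by (rule sum_in_smallo(2)[OF expansion_at_remainder[OF d] expansion_at_remainder[OF c]])
    moreover have "(F x - v) - (F x - u) = u - v" for x and u v :: real by simp
    ultimately show ?thesis by (simp only:)
  qed
  from landau_o.small.compose[OF this filterlim_ray[OF n]]
  have "(\<lambda>t. ?D (y + t *\<^sub>R n)) \<in> o[at_right 0](\<lambda>t. norm (y + t *\<^sub>R n - y) ^ N)" .
  from smalloD_tendsto[OF this]
  have lim0: "((\<lambda>t. ?D (y + t *\<^sub>R n) / norm (y + t *\<^sub>R n - y) ^ N) \<longlongrightarrow> 0) (at_right 0)" .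
  define h where "h t = (\<Sum>e\<in>I. t powr (e - m) * (c e n - d e n))" for t :: real
  have eq: "?D (y + t *\<^sub>R n) = t powr m * h t" if "t > 0" for t
  proof -
    have "(\<Sum>e | e \<in> A \<and> e \<le> real N. radial_term y e (c e) (y + t *\<^sub>R n)) = (\<Sum>e\<in>I. t powr e * c e n)"
      using that n zero
      by (intro sum.mono_neutral_cong_left I) (auto simp: I_def radial_term_sphere)
    moreover have "(\<Sum>e | e \<in> B \<and> e \<le> real N. radial_term y e (d e) (y + t *\<^sub>R n)) = (\<Sum>e\<in>I. t powr e * d e n)"
      using that n zero'
      by (intro sum.mono_neutral_cong_left I) (auto simp: I_def radial_term_sphere)
    moreover have "t powr m * h t = (\<Sum>e\<in>I. t powr e * (c e n - d e n))"
    proof -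
      have "t powr m * t powr (e - m) = t powr e" for e
        using powr_add[of t m "e - m"] by simp
      then show ?thesis by (simp add: h_def sum_distrib_left flip: mult.assoc)
    qed
    ultimately show ?thesis
      by (simp add: right_diff_distrib sum_subtractf)
  qed
  have "((\<lambda>t. ?D (y + t *\<^sub>R n) / norm (y + t *\<^sub>R n - y) ^ N * t powr (N - m)) \<longlongrightarrow> 0 * 0) (at_right 0)"
    using N m by (intro tendsto_mult lim0 powr_tendsto_0_at_right) auto
  moreover have "\<forall>\<^sub>F t in at_right 0. ?D (y + t *\<^sub>R n) / norm (y + t *\<^sub>R n - y) ^ N * t powr (N - m) = h t"
    using eventually_at_right_less[of 0]
  proof eventually_elim
    case (elim t)
    have "norm (y + t *\<^sub>R n - y) ^ N = t powr N"
      using elim n by (simp add: powr_realpow)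
    then have "?D (y + t *\<^sub>R n) / norm (y + t *\<^sub>R n - y) ^ N * t powr (N - m)
        = (t powr m * t powr (N - m) / t powr N) * h t"
      unfolding eq[OF elim] by simp
    also have "t powr m * t powr (N - m) / t powr N = 1"
      using elim by (simp flip: powr_add)
    finally show ?case by simp
  qed
  ultimately have "(h \<longlongrightarrow> 0 * 0) (at_right 0)"
    by (rule Lim_transform_eventually)
  \<comment> \<open>Termwise limit: exponents below \<open>m\<close> have equal coefficients,
    \<open>m\<close> gives a constant, and higher exponents give positive powers of
    \<open>t\<close>.\<close>
  moreover have "(h \<longlongrightarrow> (\<Sum>e\<in>I. if e = m then c m n - d m n else 0)) (at_right 0)"
    unfolding h_def
  proof (rule tendsto_sum)
    fix e
    consider "e < m" | "e = m" | "e > m" by linarith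
    then show "((\<lambda>t. t powr (e - m) * (c e n - d e n)) \<longlongrightarrow> (if e = m then c m n - d m n else 0)) (at_right 0)"
    proof cases
      case 1
      then show ?thesis using below by simp
    next
      case 2
      have "\<forall>\<^sub>F t::real in at_right 0. c m n - d m n = t powr (e - m) * (c e n - d e n)"
        using eventually_at_right_less[of 0] by eventually_elim (simp add: 2)
      then show ?thesis
        using 2 by (auto intro: Lim_transform_eventually[OF tendsto_const])
    next
      case 3
      then show ?thesis
        using tendsto_mult_left_zero[OF powr_tendsto_0_at_right, of "e - m" "c e n - d e n"] by simp
    qed
  qed
  ultimately have "0 * 0 = (\<Sum>e\<in>I. if e = m then c m n - d m n else 0)"
    by (rule tendsto_unique[rotated]) simp
  moreover have "m \<in> I" using m N by (auto simp: I_def)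
  ultimately show False using m I by simp
qed

text \<open>Any concrete expansion evaluates the definite description. The equality is one of
  functions, because coefficients are forced to 0 off the sphere and at non-exponents.\<close>

lemma coeff_at_eq:
  assumes "expansion_at y F A c"
  shows "coeff_at y F = c"
  unfolding coeff_at_def
proof (rule the_equality)
  fix d assume "\<exists>B. expansion_at y F B d"
  then show "d = c" using expansion_at_coeff_unique[OF _ assms] by blast
qed (use assms in blast)

subsection \<open>Expansions and gradients of homogeneous terms\<close>

lemma expansion_at_finite: "expansion_at y F A c \<Longrightarrow> finite {a \<in> A. a \<le> M}"
  by (simp add: expansion_at_def)

lemma expansion_at_zero: "expansion_at y F A c \<Longrightarrow> a \<notin> A \<Longrightarrow> c a n = 0"
  by (simp add: expansion_at_def)

lemma sphere_bounded:
  fixes f :: "real^3 \<Rightarrow> real"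
  assumes "continuous_on (sphere 0 1) f"
  obtains M where "\<And>n. norm n = 1 \<Longrightarrow> \<bar>f n\<bar> \<le> M" "M \<ge> 0"
proof -
  have "bounded (f ` sphere 0 1)"
    by (intro compact_imp_bounded compact_continuous_image assms compact_sphere)
  then obtain M where "\<forall>n\<in>sphere 0 1. norm (f n) \<le> M"
    by (auto simp: bounded_iff)
  then have "\<bar>f n\<bar> \<le> \<bar>M\<bar>" if "norm n = 1" for n
    using that by force
  then show ?thesis using that by (metis abs_ge_zero)
qed

lemma norm_diff_tendsto_0: "((\<lambda>x. norm (x - y)) \<longlongrightarrow> 0) (at y)"
  using tendsto_norm_zero[OF LIM_zero[OF tendsto_ident_at, of y UNIV]] by simp

lemma filterlim_norm_diff: "filterlim (\<lambda>x. norm (x - y)) (at_right 0) (at (y::real^3))"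
  unfolding filterlim_at using norm_diff_tendsto_0[of y]
  by (auto simp: eventually_at_filter)

text \<open>Used to discard terms whose exponent is pushed past the truncation order by a shift. The
  coefficient is bounded on the compact sphere.\<close>

lemma radial_term_smallo:
  assumes f: "continuous_on (sphere 0 1) f" and "real N < a"
  shows "radial_term y a f \<in> o[at y](\<lambda>x. norm (x - y) ^ N)"
proof (rule smalloI_tendsto)
  obtain M where M: "\<And>n. norm n = 1 \<Longrightarrow> \<bar>f n\<bar> \<le> M" "M \<ge> 0"
    using sphere_bounded[OF f] by blast
  have "((\<lambda>x. M * norm (x - y) powr (a - N)) \<longlongrightarrow> M * 0) (at y)"
    using \<open>real N < a\<close>
    by (intro tendsto_mult_left filterlim_compose[OF powr_tendsto_0_at_right filterlim_norm_diff]) auto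
  moreover have "\<forall>\<^sub>F x in at y. norm (radial_term y a f x / norm (x - y) ^ N) \<le> M * norm (x - y) powr (a - N)"
  proof (rule eventually_mono[OF eventually_neq_at_within])
    fix x assume "x \<noteq> y"
    then have "radial_term y a f x / norm (x - y) ^ N = norm (x - y) powr (a - N) * f (unit_dir y x)"
      by (simp add: radial_term_def powr_diff powr_realpow)
    moreover have "\<bar>f (unit_dir y x)\<bar> \<le> M" using \<open>x \<noteq> y\<close> by (intro M) simp
    ultimately show "norm (radial_term y a f x / norm (x - y) ^ N) \<le> M * norm (x - y) powr (a - N)"
      by (simp add: abs_mult mult.commute mult_right_mono)
  qed
  ultimately show "((\<lambda>x. radial_term y a f x / norm (x - y) ^ N) \<longlongrightarrow> 0) (at y)"
    by (auto intro: Lim_null_comparison)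
  show "\<forall>\<^sub>F x in at y. norm (x - y) ^ N \<noteq> 0"
    by (rule eventually_mono[OF eventually_neq_at_within]) auto
qed

lemma unit_dir_component_le: "\<bar>unit_dir y x $ i\<bar> \<le> 1"
proof -
  have "norm (unit_dir y x) \<le> 1" by (cases "x = y") (simp_all add: unit_dir_def)
  then show ?thesis using component_le_norm_cart[of "unit_dir y x" i] by linarith
qed

text \<open>The weight n^i r^2 raises every exponent by 2 and is bounded near \<open>y\<close>, so
  it keeps the remainder small.\<close>

lemma expansion_at_weighted:
  assumes F: "expansion_at y F A c" and cont: "\<And>a. a \<in> A \<Longrightarrow> continuous_on (sphere 0 1) (c a)"
  shows "expansion_at y (\<lambda>x. unit_dir y x $ i * norm (x - y) ^ 2 * F x)
           ((\<lambda>a. a + 2) ` A) (\<lambda>b n. n $ i * c (b - 2) n)"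
  unfolding expansion_at_def
proof (intro conjI allI impI)
  fix M
  have "{a \<in> (\<lambda>a. a + 2) ` A. a \<le> M} = (\<lambda>a. a + 2) ` {a \<in> A. a \<le> M - 2}" by auto
  then show "finite {a \<in> (\<lambda>a. a + 2) ` A. a \<le> M}" using expansion_at_finite[OF F] by simp
next
  fix b :: real and n :: "real^3"
  assume "b \<notin> (\<lambda>a. a + 2) ` A \<or> n \<notin> sphere 0 1"
  then have "b - 2 \<notin> A \<or> n \<notin> sphere 0 1" by (metis diff_add_cancel imageI)
  then show "n $ i * c (b - 2) n = 0" using F by (auto simp: expansion_at_def)
next
  fix N :: nat
  let ?w = "\<lambda>x. unit_dir y x $ i * norm (x - y) ^ 2"
  let ?R = "\<lambda>x. F x - (\<Sum>a | a \<in> A \<and> a \<le> real N. radial_term y a (c a) x)"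
  \<comment> \<open>The surplus terms: exponents kept in the expansion of \<open>F\<close> up to
    order \<open>N\<close> that exceed \<open>N\<close> once raised by 2. They are absorbed into the
    remainder.\<close>
  let ?I = "{a \<in> A. a \<le> real N} - {a \<in> A. a + 2 \<le> real N}"
  have "?w \<in> O[at y](\<lambda>x. 1)"
  proof (rule bigoI[of _ 1])
    have "\<forall>\<^sub>F x in at y. norm (x - y) < 1"
      using order_tendstoD(2)[OF norm_diff_tendsto_0, of 1 y] by simp
    then show "\<forall>\<^sub>F x in at y. norm (?w x) \<le> 1 * norm (1::real)"
    proof eventually_elim
      case (elim x)
      then have "norm (x - y) ^ 2 \<le> 1" by (simp add: power_le_one)
      then have "\<bar>unit_dir y x $ i\<bar> * norm (x - y) ^ 2 \<le> 1 * 1"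
        by (intro mult_mono unit_dir_component_le) auto
      then show ?case by (simp add: abs_mult)
    qed
  qed
  moreover have "?R \<in> o[at y](\<lambda>x. norm (x - y) ^ N)"
    using F by (auto simp: expansion_at_def)
  ultimately have "(\<lambda>x. ?w x * ?R x) \<in> o[at y](\<lambda>x. 1 * norm (x - y) ^ N)"
    by (rule landau_o.big_small_mult)
  moreover have "(\<lambda>x. \<Sum>a\<in>?I. radial_term y (a + 2) (\<lambda>n. n $ i * c a n) x) \<in> o[at y](\<lambda>x. norm (x - y) ^ N)"
  proof (rule big_sum_in_smallo)
    fix a assume "a \<in> ?I"
    then show "radial_term y (a + 2) (\<lambda>n. n $ i * c a n) \<in> o[at y](\<lambda>x. norm (x - y) ^ N)"
      by (intro radial_term_smallo continuous_intros cont) auto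
  qed
  ultimately have "(\<lambda>x. ?w x * ?R x + (\<Sum>a\<in>?I. radial_term y (a + 2) (\<lambda>n. n $ i * c a n) x))
      \<in> o[at y](\<lambda>x. norm (x - y) ^ N)"
    by (intro sum_in_smallo) simp_all
  moreover have "\<forall>\<^sub>F x in at y. ?w x * ?R x + (\<Sum>a\<in>?I. radial_term y (a + 2) (\<lambda>n. n $ i * c a n) x)
     = ?w x * F x - (\<Sum>b | b \<in> (\<lambda>a. a + 2) ` A \<and> b \<le> real N. radial_term y b (\<lambda>n. n $ i * c (b - 2) n) x)"
  proof (rule eventually_mono[OF eventually_neq_at_within])
    fix x assume x: "x \<noteq> y"
    have fin: "finite {a \<in> A. a \<le> real N}" using expansion_at_finite[OF F] .
    have set: "{b. b \<in> (\<lambda>a. a + 2) ` A \<and> b \<le> real N} = (\<lambda>a. a + 2) ` {a \<in> A. a + 2 \<le> real N}" by auto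
    have "(\<Sum>b | b \<in> (\<lambda>a. a + 2) ` A \<and> b \<le> real N. radial_term y b (\<lambda>n. n $ i * c (b - 2) n) x)
       = (\<Sum>a\<in>{a \<in> A. a + 2 \<le> real N}. radial_term y (a + 2) (\<lambda>n. n $ i * c a n) x)"
      unfolding set by (subst sum.reindex) (auto simp: inj_on_def)
    moreover have "?w x * radial_term y a (c a) x = radial_term y (a + 2) (\<lambda>n. n $ i * c a n) x" for a
      using x by (simp add: radial_term_def powr_add powr_numeral)
    then have "?w x * (\<Sum>a | a \<in> A \<and> a \<le> real N. radial_term y a (c a) x)
       = (\<Sum>a\<in>{a \<in> A. a \<le> real N}. radial_term y (a + 2) (\<lambda>n. n $ i * c a n) x)"
      by (simp add: sum_distrib_left)
    moreover have "\<dots> = (\<Sum>a\<in>?I. radial_term y (a + 2) (\<lambda>n. n $ i * c a n) x)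
       + (\<Sum>a\<in>{a \<in> A. a + 2 \<le> real N}. radial_term y (a + 2) (\<lambda>n. n $ i * c a n) x)"
      by (rule sum.subset_diff[OF _ fin]) auto
    ultimately show "?w x * ?R x + (\<Sum>a\<in>?I. radial_term y (a + 2) (\<lambda>n. n $ i * c a n) x)
     = ?w x * F x - (\<Sum>b | b \<in> (\<lambda>a. a + 2) ` A \<and> b \<le> real N. radial_term y b (\<lambda>n. n $ i * c (b - 2) n) x)"
      by (simp add: right_diff_distrib)
  qed
  ultimately show "(\<lambda>x. ?w x * F x - (\<Sum>b | b \<in> (\<lambda>a. a + 2) ` A \<and> b \<le> real N.
      radial_term y b (\<lambda>n. n $ i * c (b - 2) n) x)) \<in> o[at y](\<lambda>x. norm (x - y) ^ N)"
    by (rule landau_o.small.in_cong[THEN iffD1, rotated])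
qed

section \<open>Gradients of smooth functions and of homogeneous terms\<close>

lemma partial_eq:
  assumes "C1_on U H g" "x \<in> U"
  shows "partial i H x = g x $ i"
proof -
  have "(H has_derivative (\<lambda>v. g x \<bullet> v)) (at x)" using assms by (auto simp: C1_on_def)
  from frechet_derivative_at[OF this, symmetric] show ?thesis
    by (simp add: partial_def inner_axis)
qed

text \<open>The empty list of derivatives gives the total differential, which is linear and so
  determined by its values on the axes; the one-element lists give continuity of the
  gradient.\<close>

lemma smooth_on_C1:
  assumes "open U" "smooth_on U F"
  shows "C1_on U F (\<lambda>x. \<chi> i. partial i F x)"
  unfolding C1_on_def
proof (intro conjI ballI)
  fix x assume "x \<in> U"
  have "F differentiable_on U" using assms(2)[unfolded smooth_on_def, rule_format, of "[]"] by simp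
  then have "F differentiable at x"
    using \<open>x \<in> U\<close> at_within_open[OF \<open>x \<in> U\<close> \<open>open U\<close>] unfolding differentiable_on_def by metis
  then have D: "(F has_derivative frechet_derivative F (at x)) (at x)"
    by (simp add: frechet_derivative_works)
  have "frechet_derivative F (at x) v = (\<chi> i. partial i F x) \<bullet> v" for v
  proof -
    interpret bounded_linear "frechet_derivative F (at x)" by (rule has_derivative_bounded_linear[OF D])
    have "v = (\<Sum>i\<in>UNIV. v $ i *\<^sub>R axis i 1)"
      by (simp add: vec_eq_iff axis_def if_distrib cong: if_cong)
    then have "frechet_derivative F (at x) v = frechet_derivative F (at x) (\<Sum>i\<in>UNIV. v $ i *\<^sub>R axis i 1)"
      by simp
    also have "\<dots> = (\<Sum>i\<in>UNIV. v $ i * partial i F x)"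
      by (simp add: sum scaleR partial_def)
    finally show ?thesis by (simp add: inner_vec_def mult.commute)
  qed
  then show "(F has_derivative (\<lambda>v. (\<chi> i. partial i F x) \<bullet> v)) (at x)"
    using D by presburger
next
  have "partial i F differentiable_on U" for i
    using assms(2)[unfolded smooth_on_def, rule_format, of "[i]"] by simp
  then show "continuous_on U (\<lambda>x. \<chi> i. partial i F x)"
    by (intro continuous_on_vec_lambda differentiable_imp_continuous_on)
qed

lemma smooth_on_sphere_continuous:
  assumes "smooth_on_sphere f"
  shows "continuous_on (sphere 0 1) f"
proof -
  obtain U g where U: "open U" "sphere 0 1 \<subseteq> U" "smooth_on U g" "\<forall>n\<in>sphere 0 1. g n = f n"
    using assms unfolding smooth_on_sphere_def by blast
  have "continuous_on (sphere 0 1) g"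
    using C1_on_continuous[OF smooth_on_C1[OF U(1,3)]] U(2) continuous_on_subset by blast
  then show ?thesis using continuous_on_cong[OF refl, of "sphere 0 1" g f] U(4) by blast
qed

text \<open>The chain rule for r^a h(n), where \<open>h\<close> is a smooth extension of the
  coefficient to a neighbourhood of the sphere.\<close>

lemma radial_term_C1:
  assumes "smooth_on_sphere f"
  obtains g where "C1_on (- {y}) (radial_term y a f) g"
proof -
  obtain U h where U: "open U" "sphere 0 1 \<subseteq> U" "smooth_on U h" "\<forall>n\<in>sphere 0 1. h n = f n"
    using assms unfolding smooth_on_sphere_def by blast
  have hf: "h (unit_dir y x) = f (unit_dir y x)" if "x \<noteq> y" for x
    using U(4) norm_unit_dir[OF that] by (metis mem_sphere_0)
  define k where "k x = (\<chi> i. partial i h x)" for x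
  have h: "(h has_derivative (\<lambda>v. k x \<bullet> v)) (at x)" if "x \<in> U" for x
    using smooth_on_C1[OF U(1,3)] that by (simp add: C1_on_def k_def)
  have k: "continuous_on U k" and ch: "continuous_on U h"
    using smooth_on_C1[OF U(1,3)] C1_on_continuous[OF smooth_on_C1[OF U(1,3)]] by (simp_all add: C1_on_def k_def)
  \<comment> \<open>In terms of n = (x - y)/r this is r^(a-1) times (a h n + k - (k . n) n): a
    radial part and the tangential projection of the gradient \<open>k\<close> of
    \<open>h\<close>.\<close>
  define g where "g x = (a * norm (x - y) powr (a - 2) * h (unit_dir y x)) *\<^sub>R (x - y)
      + norm (x - y) powr (a - 1) *\<^sub>R k (unit_dir y x)
      - (norm (x - y) powr (a - 3) * (k (unit_dir y x) \<bullet> (x - y))) *\<^sub>R (x - y)" for x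
  have "C1_on (- {y}) (radial_term y a f) g"
    unfolding C1_on_def
  proof (intro conjI ballI)
    fix x assume "x \<in> - {y}"
    then have x: "x \<noteq> y" by simp
    then have uU: "unit_dir y x \<in> U" using U(2) by auto
    define r where "r = norm (x - y)"
    have r: "r > 0" using x by (simp add: r_def)
    have ds: "((\<lambda>x. x - y) has_derivative (\<lambda>v. v)) (at x)"
      by (auto intro!: derivative_eq_intros)
    have "(norm has_derivative (\<lambda>v. v \<bullet> sgn (x - y))) (at (x - y))"
      using x by (intro has_derivative_norm) simp
    from has_derivative_compose_o[OF ds this]
    have d1: "((\<lambda>x. norm (x - y)) has_derivative (\<lambda>v. ((x - y) \<bullet> v) / r)) (at x)"
      by (simp add: o_def sgn_div_norm r_def inner_commute divide_inverse mult.commute)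
    \<comment> \<open>With r^(a-3) as common factor, the real powers of \<open>r\<close> that occur
      become \<open>q\<close> times integer powers, so the comparison below is plain
      algebra.\<close>
    define q where "q = r powr (a - 3)"
    have q: "r powr (a - 3) = q" "r powr (a - 2) = q * r" "r powr (a - 1) = q * r\<^sup>2" "r powr a = q * r ^ 3"
      using r powr_add[of r "a - 3" 1] powr_add[of r "a - 3" 2] powr_add[of r "a - 3" 3]
      by (simp_all add: q_def powr_numeral)
    have d2: "((\<lambda>x. norm (x - y) powr a) has_derivative (\<lambda>v. a * (q * r) * ((x - y) \<bullet> v))) (at x)"
    proof -
      have "((\<lambda>t. t powr a) has_derivative (\<lambda>v. a * (q * r\<^sup>2) * v)) (at r)"
        using has_real_derivative_powr[OF r, of a] by (simp add: has_field_derivative_def q)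
      from has_derivative_compose_o[OF d1, of "\<lambda>t. t powr a", folded r_def, OF this]
      show ?thesis using r by (simp add: o_def r_def[symmetric] power2_eq_square mult.assoc)
    qed
    have d3: "(unit_dir y has_derivative (\<lambda>v. v /\<^sub>R r - (((x - y) \<bullet> v) / r ^ 3) *\<^sub>R (x - y))) (at x)"
    proof -
      have "((\<lambda>x. inverse (norm (x - y))) has_derivative (\<lambda>v. - (inverse r * (((x - y) \<bullet> v) / r) * inverse r))) (at x)"
        using Deriv.has_derivative_inverse[OF _ d1] x by (simp add: r_def)
      from has_derivative_scaleR[OF this ds] show ?thesis
        unfolding unit_dir_def[abs_def] r_def[symmetric]
        by (rule has_derivative_eq_rhs) (simp add: fun_eq_iff divide_inverse power3_eq_cube ac_simps)
    qed
    have d4: "((\<lambda>x. h (unit_dir y x)) has_derivative (\<lambda>v. k (unit_dir y x) \<bullet> (v /\<^sub>R r - (((x - y) \<bullet> v) / r ^ 3) *\<^sub>R (x - y)))) (at x)"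
      using has_derivative_compose_o[OF d3 h[OF uU]] by (simp add: o_def)
    have "((\<lambda>x. norm (x - y) powr a * h (unit_dir y x)) has_derivative (\<lambda>v. g x \<bullet> v)) (at x)"
    proof (rule has_derivative_eq_rhs[OF has_derivative_mult[OF d2 d4]], rule ext)
      fix v
      have "g x \<bullet> v = a * (q * r) * h (unit_dir y x) * ((x - y) \<bullet> v) + q * r\<^sup>2 * (k (unit_dir y x) \<bullet> v)
          - q * (k (unit_dir y x) \<bullet> (x - y)) * ((x - y) \<bullet> v)"
        by (simp add: g_def r_def[symmetric] q inner_add_left inner_diff_left)
      moreover have "k (unit_dir y x) \<bullet> (v /\<^sub>R r - (((x - y) \<bullet> v) / r ^ 3) *\<^sub>R (x - y))
          = (k (unit_dir y x) \<bullet> v) / r - ((x - y) \<bullet> v) / r ^ 3 * (k (unit_dir y x) \<bullet> (x - y))"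
        by (simp add: inner_diff_right divide_inverse mult.commute)
      moreover have "q * r ^ 3 * ((k (unit_dir y x) \<bullet> v) / r - ((x - y) \<bullet> v) / r ^ 3 * (k (unit_dir y x) \<bullet> (x - y)))
          = q * r\<^sup>2 * (k (unit_dir y x) \<bullet> v) - q * (k (unit_dir y x) \<bullet> (x - y)) * ((x - y) \<bullet> v)"
        using r by (simp add: right_diff_distrib power3_eq_cube power2_eq_square)
      ultimately show "norm (x - y) powr a * (k (unit_dir y x) \<bullet> (v /\<^sub>R r - (((x - y) \<bullet> v) / r ^ 3) *\<^sub>R (x - y)))
          + a * (q * r) * ((x - y) \<bullet> v) * h (unit_dir y x) = g x \<bullet> v"
        by (simp add: r_def[symmetric] q mult.commute mult.left_commute)
    qed
    then show "(radial_term y a f has_derivative (\<lambda>v. g x \<bullet> v)) (at x)"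
      by (rule has_derivative_transform_within_open[where s = "- {y}"])
         (use x hf in \<open>simp_all add: radial_term_def open_Compl\<close>)
  next
    have u: "continuous_on (- {y}) (unit_dir y)"
      unfolding unit_dir_def[abs_def] by (intro continuous_intros) auto
    have "unit_dir y ` (- {y}) \<subseteq> sphere 0 1" by (rule image_subsetI) simp
    then have "unit_dir y ` (- {y}) \<subseteq> U" using U(2) by (rule subset_trans)
    then have "continuous_on (- {y}) (\<lambda>x. h (unit_dir y x))" "continuous_on (- {y}) (\<lambda>x. k (unit_dir y x))"
      using continuous_on_compose2[OF ch u] continuous_on_compose2[OF k u] by blast+
    then show "continuous_on (- {y}) g"
      unfolding g_def[abs_def] by (intro continuous_intros) auto
  qed
  then show ?thesis by (rule that)
qed

text \<open>Differentiate H(y + r (x - y)) = r^a H(x) at x = y + n in two ways and compare the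
  derivatives. A gradient of a term of degree \<open>a\<close> is thus homogeneous of degree a -
  1.\<close>

lemma radial_term_gradient_homogeneous:
  assumes g: "C1_on (- {y}) (radial_term y a f) g" and "r > 0" "norm n = 1"
  shows "g (y + r *\<^sub>R n) = r powr (a - 1) *\<^sub>R g (y + n)"
proof -
  let ?H = "radial_term y a f"
  have ne: "y + r *\<^sub>R n \<in> - {y}" "y + n \<in> - {y}" using assms(2,3) by auto
  have D1: "(?H has_derivative (\<lambda>v. g (y + n) \<bullet> v)) (at (y + n))"
    and D2: "(?H has_derivative (\<lambda>v. g (y + r *\<^sub>R n) \<bullet> v)) (at (y + r *\<^sub>R n))"
    using g ne by (auto simp: C1_on_def)
  have hom: "?H (y + r *\<^sub>R (x - y)) = r powr a * ?H x" for x
  proof -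
    have "inverse (r * norm (x - y)) * r = inverse (norm (x - y))"
      using \<open>r > 0\<close> by (cases "x = y") (simp_all add: field_simps)
    moreover have "unit_dir y (y + r *\<^sub>R (x - y)) = (inverse (r * norm (x - y)) * r) *\<^sub>R (x - y)"
      using \<open>r > 0\<close> by (simp add: unit_dir_def)
    ultimately have "unit_dir y (y + r *\<^sub>R (x - y)) = unit_dir y x"
      by (simp only: unit_dir_def)
    then show ?thesis
      using \<open>r > 0\<close> by (simp add: radial_term_def powr_mult)
  qed
  have "((\<lambda>x. y + r *\<^sub>R (x - y)) has_derivative (\<lambda>v. r *\<^sub>R v)) (at (y + n))"
    by (auto intro!: derivative_eq_intros)
  from has_derivative_compose_o[OF this, of ?H "\<lambda>v. g (y + r *\<^sub>R n) \<bullet> v"] D2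
  have "((\<lambda>x. r powr a * ?H x) has_derivative (\<lambda>v. r * (g (y + r *\<^sub>R n) \<bullet> v))) (at (y + n))"
    by (simp add: hom o_def)
  moreover have "((\<lambda>x. r powr a * ?H x) has_derivative (\<lambda>v. r powr a * (g (y + n) \<bullet> v))) (at (y + n))"
    by (intro derivative_intros D1)
  ultimately have "(\<lambda>v. r * (g (y + r *\<^sub>R n) \<bullet> v)) = (\<lambda>v. r powr a * (g (y + n) \<bullet> v))"
    by (rule has_derivative_unique)
  then have "r * (g (y + r *\<^sub>R n) \<bullet> v) = r powr a * (g (y + n) \<bullet> v)" for v by meson
  then have "g (y + r *\<^sub>R n) \<bullet> v = (r powr (a - 1) *\<^sub>R g (y + n)) \<bullet> v" for v
    using \<open>r > 0\<close> by (simp add: powr_diff field_simps)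
  then show ?thesis by (metis vector_eq_rdot)
qed

text \<open>Two computations of the derivative of the flux at r = 1: by the divergence theorem, and
  from the explicit flux, which is a constant times r^(a+2).\<close>

lemma angular_integral_radial_gradient:
  assumes g: "C1_on (- {y}) (radial_term y a f) g" and f: "continuous_on (sphere 0 1) f"
  shows "angular_integral (\<lambda>n. g (y + n) $ i) = (a + 2) * angular_integral (\<lambda>n. n $ i * f n)"
proof -
  let ?\<Phi> = "angular_integral (\<lambda>n. n $ i * f n)"
  have flux: "flux i y (radial_term y a f) r = r powr (a + 2) * ?\<Phi>" if "r > 0" for r
  proof -
    have "angular_integral (\<lambda>n. n $ i * radial_term y a f (y + r *\<^sub>R n)) = angular_integral (\<lambda>n. r powr a * (n $ i * f n))"
      by (rule angular_integral_cong) (use that in \<open>simp add: radial_term_sphere\<close>)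
    also have "\<dots> = r powr a * ?\<Phi>"
      by (intro angular_integral_cmult continuous_intros f)
    finally show ?thesis
      using that by (simp add: flux_def powr_add powr_numeral)
  qed
  have "(flux i y (radial_term y a f) has_real_derivative angular_integral (\<lambda>n. g (y + n) $ i)) (at 1)"
    using flux_has_derivative[OF g, of 1 i] by simp
  moreover have "((\<lambda>r. r powr (a + 2) * ?\<Phi>) has_real_derivative (a + 2) * ?\<Phi>) (at 1)"
    by (auto intro!: derivative_eq_intros)
  then have "(flux i y (radial_term y a f) has_real_derivative (a + 2) * ?\<Phi>) (at 1)"
  proof (rule DERIV_cong_ev[THEN iffD1, rotated -1])
    have "\<forall>\<^sub>F r in nhds 1. r \<in> {0::real<..}" by (rule eventually_nhds_in_open) auto
    then show "\<forall>\<^sub>F r in nhds 1. r powr (a + 2) * ?\<Phi> = flux i y (radial_term y a f) r"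
      by eventually_elim (simp add: flux)
  qed auto
  ultimately show ?thesis by (rule DERIV_unique)
qed

subsection \<open>The divergent part of the flux\<close>

text \<open>An exponent \<open>b\<close> of the derivative comes from a = b + 1, so the factor a + 2
  of the homogeneous case reads b + 3. This is the denominator in the counterterms, and it vanishes
  at the logarithmic exponent -3.\<close>

lemma expansion_at_partial:
  assumes E: "smooth_expansion_at y F A c"
  obtains c' where "expansion_at y (partial i F) ((\<lambda>a. a - 1) ` A) c'"
    and "\<And>b. angular_integral (c' b) = (b + 3) * angular_integral (\<lambda>n. n $ i * c (b + 1) n)"
proof -
  have F: "expansion_at y F A c" and smooth: "\<And>a. a \<in> A \<Longrightarrow> smooth_on_sphere (c a)"
    using E by (simp_all add: smooth_expansion_at_def)
  have "\<exists>g. C1_on (- {y}) (radial_term y a (c a)) g" if "a \<in> A" for a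
    using radial_term_C1[OF smooth[OF that]] by blast
  then obtain g where g: "\<And>a. a \<in> A \<Longrightarrow> C1_on (- {y}) (radial_term y a (c a)) (g a)"
    by metis
  \<comment> \<open>The gradient at unit distance from \<open>y\<close> is the coefficient;
    homogeneity supplies the power of r. Zero elsewhere, as the convention for expansions
    demands.\<close>
  define c' where "c' b n = (if b + 1 \<in> A \<and> norm n = 1 then g (b + 1) (y + n) $ i else 0)" for b n
  show ?thesis
  proof (rule that)
    show "angular_integral (c' b) = (b + 3) * angular_integral (\<lambda>n. n $ i * c (b + 1) n)" for b
    proof (cases "b + 1 \<in> A")
      case True
      have "angular_integral (c' b) = angular_integral (\<lambda>n. g (b + 1) (y + n) $ i)"
        by (rule angular_integral_cong) (simp add: c'_def True)
      then show ?thesis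
        using angular_integral_radial_gradient[OF g[OF True] smooth_on_sphere_continuous[OF smooth[OF True]], of i]
        by (simp add: add.commute)
    next
      case False
      then show ?thesis
        by (simp add: c'_def[abs_def] expansion_at_zero[OF F])
    qed
    show "expansion_at y (partial i F) ((\<lambda>a. a - 1) ` A) c'"
      unfolding expansion_at_def
    proof (intro conjI allI impI)
      fix M
      have "{a \<in> (\<lambda>a. a - 1) ` A. a \<le> M} = (\<lambda>a. a - 1) ` {a \<in> A. a \<le> M + 1}" by auto
      then show "finite {a \<in> (\<lambda>a. a - 1) ` A. a \<le> M}" using expansion_at_finite[OF F] by simp
    next
      fix b :: real and n :: "real^3"
      assume "b \<notin> (\<lambda>a. a - 1) ` A \<or> n \<notin> sphere 0 1"
      moreover have "b \<in> (\<lambda>a. a - 1) ` A" if "b + 1 \<in> A"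
        using that by (metis add_diff_cancel imageI)
      ultimately show "c' b n = 0" by (auto simp: c'_def)
    next
      fix N :: nat
      \<comment> \<open>One derivative shifts the cutoff by one: a <= N + 1 corresponds exactly to a
        - 1 <= N.\<close>
      have "(\<lambda>x. iter_partial [i] F x - (\<Sum>a | a \<in> A \<and> a \<le> real N + real (length [i]).
          iter_partial [i] (radial_term y a (c a)) x)) \<in> o[at y](\<lambda>x. norm (x - y) ^ N)"
        using E unfolding smooth_expansion_at_def by blast
      moreover have "\<forall>\<^sub>F x in at y. iter_partial [i] F x - (\<Sum>a | a \<in> A \<and> a \<le> real N + real (length [i]).
          iter_partial [i] (radial_term y a (c a)) x)
        = partial i F x - (\<Sum>b | b \<in> (\<lambda>a. a - 1) ` A \<and> b \<le> real N. radial_term y b (c' b) x)"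
      proof (rule eventually_mono[OF eventually_neq_at_within])
        fix x assume x: "x \<noteq> y"
        have set: "{b. b \<in> (\<lambda>a. a - 1) ` A \<and> b \<le> real N} = (\<lambda>a. a - 1) ` {a \<in> A. a \<le> real N + 1}" by auto
        have "(\<Sum>b | b \<in> (\<lambda>a. a - 1) ` A \<and> b \<le> real N. radial_term y b (c' b) x)
          = (\<Sum>a\<in>{a \<in> A. a \<le> real N + 1}. radial_term y (a - 1) (c' (a - 1)) x)"
          unfolding set by (subst sum.reindex) (auto simp: inj_on_def)
        also have "\<dots> = (\<Sum>a\<in>{a \<in> A. a \<le> real N + 1}. partial i (radial_term y a (c a)) x)"
        proof (rule sum.cong)
          fix a assume "a \<in> {a \<in> A. a \<le> real N + 1}"
          then have a: "a \<in> A" by simp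
          have "partial i (radial_term y a (c a)) x = g a x $ i"
            by (rule partial_eq[OF g[OF a]]) (use x in simp)
          also have "g a x = norm (x - y) powr (a - 1) *\<^sub>R g a (y + unit_dir y x)"
            using radial_term_gradient_homogeneous[OF g[OF a], of "norm (x - y)" "unit_dir y x"] x
            by (simp flip: polar_decomp)
          finally show "radial_term y (a - 1) (c' (a - 1)) x = partial i (radial_term y a (c a)) x"
            using x a by (simp add: radial_term_def[of y "a - 1"] c'_def)
        qed simp
        finally show "iter_partial [i] F x - (\<Sum>a | a \<in> A \<and> a \<le> real N + real (length [i]).
          iter_partial [i] (radial_term y a (c a)) x)
        = partial i F x - (\<Sum>b | b \<in> (\<lambda>a. a - 1) ` A \<and> b \<le> real N. radial_term y b (c' b) x)"
          by simp
      qed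
      ultimately show "(\<lambda>x. partial i F x - (\<Sum>b | b \<in> (\<lambda>a. a - 1) ` A \<and> b \<le> real N. radial_term y b (c' b) x))
          \<in> o[at y](\<lambda>x. norm (x - y) ^ N)"
        by (rule landau_o.small.in_cong[THEN iffD1, rotated])
    qed
  qed
qed

text \<open>The factor b + 3 cancels each denominator and annihilates the logarithm, so the result
  does not involve \<sigma>. The sum left is the divergent part of the flux of
  \<open>F\<close>.\<close>

lemma pf_counterterm_partial:
  assumes E: "smooth_expansion_at y F A c"
  shows "pf_counterterm y \<sigma> (partial i F) s
    = (\<Sum>a | a \<in> A \<and> a < -2. s powr (a + 2) * angular_integral (\<lambda>n. n $ i * c a n))"
proof -
  obtain c' where c': "expansion_at y (partial i F) ((\<lambda>a. a - 1) ` A) c'"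
    and ang: "\<And>b. angular_integral (c' b) = (b + 3) * angular_integral (\<lambda>n. n $ i * c (b + 1) n)"
    using expansion_at_partial[OF E] by metis
  let ?B = "{b \<in> (\<lambda>a. a - 1) ` A. b + 3 < 0}"
  have set: "?B = (\<lambda>a. a - 1) ` {a. a \<in> A \<and> a < -2}" by auto
  have fin: "finite ?B"
    by (rule finite_subset[OF _ expansion_at_finite[OF c', of "-3"]]) auto
  \<comment> \<open>The counterterm sums only over exponents with a nonzero coefficient; the other
    exponents are added back with value 0.\<close>
  have "(\<Sum>b | b + 3 < 0 \<and> (\<exists>n. c' b n \<noteq> 0). s powr (b + 3) / (b + 3) * angular_integral (c' b))
     = (\<Sum>b\<in>?B. s powr (b + 3) / (b + 3) * angular_integral (c' b))"
  proof (rule sum.mono_neutral_left[OF fin])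
    show "{b. b + 3 < 0 \<and> (\<exists>n. c' b n \<noteq> 0)} \<subseteq> ?B"
      using expansion_at_zero[OF c'] by blast
    show "\<forall>b\<in>?B - {b. b + 3 < 0 \<and> (\<exists>n. c' b n \<noteq> 0)}. s powr (b + 3) / (b + 3) * angular_integral (c' b) = 0"
    proof
      fix b assume "b \<in> ?B - {b. b + 3 < 0 \<and> (\<exists>n. c' b n \<noteq> 0)}"
      then have "c' b = (\<lambda>n. 0)" by auto
      then show "s powr (b + 3) / (b + 3) * angular_integral (c' b) = 0" by simp
    qed
  qed
  also have "\<dots> = (\<Sum>b\<in>?B. s powr (b + 3) * angular_integral (\<lambda>n. n $ i * c (b + 1) n))"
    by (rule sum.cong) (auto simp: ang)
  also have "\<dots> = (\<Sum>a | a \<in> A \<and> a < -2. s powr (a + 2) * angular_integral (\<lambda>n. n $ i * c a n))"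
    unfolding set by (subst sum.reindex) (simp_all add: inj_on_def add.commute)
  finally show ?thesis
    by (simp add: pf_counterterm_def coeff_at_eq[OF c'] ang)
qed

text \<open>Integrate the expansion of \<open>F\<close> over the sphere of radius \<open>s\<close>.
  An exponent \<open>a\<close> contributes s^(a+2): divergent for a < -2, constant for a = -2,
  vanishing for a > -2.\<close>

lemma flux_expansion:
  fixes i :: 3
  assumes F: "expansion_at y F A c" and c: "\<And>a. a \<in> A \<Longrightarrow> continuous_on (sphere 0 1) (c a)"
    and U: "open U" "y \<in> U" "continuous_on (U - {y}) F"
  defines "\<Phi> \<equiv> \<lambda>a. angular_integral (\<lambda>n. n $ i * c a n)"
  shows "((\<lambda>s. flux i y F s - (\<Sum>a | a \<in> A \<and> a < -2. s powr (a + 2) * \<Phi> a)) \<longlongrightarrow> \<Phi> (-2)) (at_right 0)"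
proof -
  \<comment> \<open>Truncation at order 0 is enough: the remainder is o(1), and the flux multiplies
    it by s^2.\<close>
  define I where "I = {a \<in> A. a \<le> 0}"
  have I: "finite I" unfolding I_def by (rule expansion_at_finite[OF F])
  define \<rho> where "\<rho> x = F x - (\<Sum>a\<in>I. radial_term y a (c a) x)" for x
  define e where "e s = angular_integral (\<lambda>n. n $ i * \<rho> (y + s *\<^sub>R n))" for s
  obtain d where d: "d > 0" "ball y d \<subseteq> U" using U openE by blast
  have cF: "continuous_on (sphere 0 1) (\<lambda>n. F (y + s *\<^sub>R n))" if "0 < s" "s < d" for s
  proof (rule continuous_on_compose2[OF U(3)])
    show "continuous_on (sphere 0 1) (\<lambda>n. y + s *\<^sub>R n)" by (intro continuous_intros)
    show "(\<lambda>n. y + s *\<^sub>R n) ` sphere 0 1 \<subseteq> U - {y}"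
      using that d(2) by (auto simp: subset_iff dist_norm)
  qed
  have c': "continuous_on (sphere 0 1) (c a)" if "a \<in> I" for a
    using that c by (simp add: I_def)
  have \<rho>_sphere: "\<rho> (y + s *\<^sub>R n) = F (y + s *\<^sub>R n) - (\<Sum>a\<in>I. s powr a * c a n)" if "0 < s" "norm n = 1" for s n
    using that by (simp add: \<rho>_def radial_term_sphere)
  have c\<rho>: "continuous_on (sphere 0 1) (\<lambda>n. \<rho> (y + s *\<^sub>R n))" if "0 < s" "s < d" for s
  proof -
    have "continuous_on (sphere 0 1) (\<lambda>n. F (y + s *\<^sub>R n) - (\<Sum>a\<in>I. s powr a * c a n))"
      by (intro continuous_intros cF c' that)
    then show ?thesis
      by (rule continuous_on_cong[THEN iffD1, rotated -1]) (use that in \<open>simp_all add: \<rho>_sphere\<close>)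
  qed
  have cn\<rho>: "continuous_on (sphere 0 1) (\<lambda>n. n $ i * \<rho> (y + s *\<^sub>R n))" if "0 < s" "s < d" for s
    by (rule continuous_on_mult[OF _ c\<rho>[OF that]]) (intro continuous_intros)
  have flux: "flux i y F s = (\<Sum>a\<in>I. s powr (a + 2) * \<Phi> a) + s\<^sup>2 * e s" if s: "0 < s" "s < d" for s
  proof -
    have "angular_integral (\<lambda>n. n $ i * F (y + s *\<^sub>R n))
        = angular_integral (\<lambda>n. (\<Sum>a\<in>I. s powr a * (n $ i * c a n)) + n $ i * \<rho> (y + s *\<^sub>R n))"
      by (rule angular_integral_cong)
         (use s in \<open>simp add: \<rho>_sphere right_diff_distrib sum_distrib_left mult.left_commute\<close>)
    also have "\<dots> = angular_integral (\<lambda>n. \<Sum>a\<in>I. s powr a * (n $ i * c a n)) + e s"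
      unfolding e_def by (rule angular_integral_add[OF _ cn\<rho>[OF s]]) (intro continuous_intros c')
    also have "angular_integral (\<lambda>n. \<Sum>a\<in>I. s powr a * (n $ i * c a n))
        = (\<Sum>a\<in>I. angular_integral (\<lambda>n. s powr a * (n $ i * c a n)))"
      by (rule angular_integral_sum) (intro continuous_intros c')
    also have "\<dots> = (\<Sum>a\<in>I. s powr a * \<Phi> a)"
      unfolding \<Phi>_def by (intro sum.cong refl angular_integral_cmult continuous_intros c')
    finally show ?thesis
      using s by (simp add: flux_def distrib_left sum_distrib_left powr_add powr_numeral mult_ac)
  qed
  have "(\<rho> \<longlongrightarrow> 0) (at y)"
    using smalloD_tendsto[OF expansion_at_remainder[OF F, of 0]] by (simp add: \<rho>_def[abs_def] I_def)
  then have e0: "(e \<longlongrightarrow> 0) (at_right 0)"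
  proof -
    assume lim: "(\<rho> \<longlongrightarrow> 0) (at y)"
    show ?thesis
    proof (rule tendstoI)
      fix \<epsilon> :: real assume "\<epsilon> > 0"
      \<comment> \<open>Makes the bound \<open>2 * pi\<^sup>2 * \<eta>\<close> on the angular
        integral equal to half of \<epsilon>.\<close>
      define \<eta> where "\<eta> = \<epsilon> / (4 * pi\<^sup>2)"
      have \<eta>: "\<eta> > 0" using \<open>\<epsilon> > 0\<close> by (simp add: \<eta>_def)
      obtain \<delta> where \<delta>: "\<delta> > 0" "\<And>x. x \<noteq> y \<Longrightarrow> dist x y < \<delta> \<Longrightarrow> \<bar>\<rho> x\<bar> < \<eta>"
        using tendstoD[OF lim \<eta>] by (auto simp: eventually_at)
      have "\<forall>\<^sub>F s in at_right 0. s \<in> {0<..<min d \<delta>}"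
        by (rule eventually_at_right_real) (use d \<delta> in simp)
      then show "\<forall>\<^sub>F s in at_right 0. dist (e s) 0 < \<epsilon>"
      proof eventually_elim
        case (elim s)
        have "\<bar>e s\<bar> \<le> 2 * pi\<^sup>2 * \<eta>"
          unfolding e_def
        proof (rule angular_integral_bound)
          show "continuous_on (sphere 0 1) (\<lambda>n. n $ i * \<rho> (y + s *\<^sub>R n))"
            using elim by (intro cn\<rho>) auto
          fix n :: "real^3" assume "n \<in> sphere 0 1"
          then have n: "norm n = 1" by simp
          have "\<bar>n $ i\<bar> \<le> 1" using component_le_norm_cart[of n i] n by simp
          moreover have "\<bar>\<rho> (y + s *\<^sub>R n)\<bar> \<le> \<eta>"
            using elim n by (intro less_imp_le \<delta>(2)) (auto simp: dist_norm)
          ultimately have "\<bar>n $ i\<bar> * \<bar>\<rho> (y + s *\<^sub>R n)\<bar> \<le> 1 * \<eta>" by (intro mult_mono) auto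
          then show "\<bar>n $ i * \<rho> (y + s *\<^sub>R n)\<bar> \<le> \<eta>" by (simp add: abs_mult)
        qed
        also have "2 * pi\<^sup>2 * \<eta> < \<epsilon>" using \<open>\<epsilon> > 0\<close> by (simp add: \<eta>_def)
        finally show ?case by simp
      qed
    qed
  qed
  \<comment> \<open>The exponents between -2 and 0, of which only -2 survives in the limit. If -2 is
    not an exponent, its coefficient is 0 and the limit is still right.\<close>
  define J where "J = {a \<in> I. -2 \<le> a}"
  have "((\<lambda>s. (\<Sum>a\<in>J. s powr (a + 2) * \<Phi> a) + s\<^sup>2 * e s) \<longlongrightarrow> (\<Sum>a\<in>J. if a = -2 then \<Phi> (-2) else 0) + 0\<^sup>2 * 0) (at_right 0)"
  proof (intro tendsto_add tendsto_sum tendsto_mult tendsto_power tendsto_ident_at e0)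
    fix a assume a: "a \<in> J"
    show "((\<lambda>s. s powr (a + 2) * \<Phi> a) \<longlongrightarrow> (if a = -2 then \<Phi> (-2) else 0)) (at_right 0)"
    proof (cases "a = -2")
      case True
      have "\<forall>\<^sub>F s::real in at_right 0. \<Phi> (-2) = s powr (a + 2) * \<Phi> a"
        using eventually_at_right_less[of 0] by eventually_elim (simp add: True)
      then show ?thesis
        using True by (auto intro: Lim_transform_eventually[OF tendsto_const])
    next
      case False
      then show ?thesis
        using a tendsto_mult_left_zero[OF powr_tendsto_0_at_right, of "a + 2" "\<Phi> a"] by (simp add: J_def)
    qed
  qed
  moreover have "(\<Sum>a\<in>J. if a = -2 then \<Phi> (-2) else 0) = \<Phi> (-2)"
  proof (cases "-2 \<in> A")
    case True
    then have "finite J" "-2 \<in> J" using I by (auto simp: J_def I_def intro: rev_finite_subset)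
    then show ?thesis by simp
  next
    case False
    then have "\<Phi> (-2) = 0" by (simp add: \<Phi>_def expansion_at_zero[OF F])
    then show ?thesis by (simp cong: if_cong)
  qed
  moreover have "\<forall>\<^sub>F s in at_right 0. (\<Sum>a\<in>J. s powr (a + 2) * \<Phi> a) + s\<^sup>2 * e s
      = flux i y F s - (\<Sum>a | a \<in> A \<and> a < -2. s powr (a + 2) * \<Phi> a)"
    using eventually_at_right_real[OF d(1)]
  proof eventually_elim
    case (elim s)
    have "I - J = {a. a \<in> A \<and> a < -2}" by (auto simp: I_def J_def)
    then have "(\<Sum>a\<in>I. s powr (a + 2) * \<Phi> a)
        = (\<Sum>a | a \<in> A \<and> a < -2. s powr (a + 2) * \<Phi> a) + (\<Sum>a\<in>J. s powr (a + 2) * \<Phi> a)"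
      using sum.subset_diff[of J I] I by (auto simp: J_def)
    then show ?case using flux[of s] elim by simp
  qed
  ultimately show ?thesis
    using Lim_transform_eventually by force
qed

subsection \<open>Localisation and decay of the flux\<close>

text \<open>Building block of the cutoff: squaring the positive part removes its kink, since the
  difference quotient at 0 is at most |h|.\<close>

lemma has_real_derivative_max_0_squared:
  "((\<lambda>t::real. (max 0 t)\<^sup>2) has_real_derivative 2 * max 0 t) (at t)"
proof -
  consider "t > 0" | "t < 0" | "t = 0" by linarith
  then show ?thesis
  proof cases
    case 1
    have "((\<lambda>t. t\<^sup>2) has_real_derivative 2 * max 0 t) (at t)"
      using 1 by (auto intro!: derivative_eq_intros)
    then show ?thesis
      by (rule has_field_derivative_transform_within_open[where S = "{0<..}"]) (use 1 in auto)
  next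
    case 2
    have "((\<lambda>t. 0) has_real_derivative 2 * max 0 t) (at t)"
      using 2 by (auto intro!: derivative_eq_intros)
    then show ?thesis
      by (rule has_field_derivative_transform_within_open[where S = "{..<0}"]) (use 2 in auto)
  next
    case 3
    have "((\<lambda>h. ((max 0 h)\<^sup>2 - (max 0 0)\<^sup>2) / h) \<longlongrightarrow> 0) (at (0::real))"
    proof (rule Lim_null_comparison)
      have "norm (((max 0 h)\<^sup>2 - (max 0 0)\<^sup>2) / h) \<le> \<bar>h\<bar>" for h :: real
        by (cases "h > 0") (auto simp: power2_eq_square max_def)
      then show "\<forall>\<^sub>F h in at (0::real). norm (((max 0 h)\<^sup>2 - (max 0 0)\<^sup>2) / h) \<le> \<bar>h\<bar>" by simp
      show "((\<lambda>h. \<bar>h\<bar>) \<longlongrightarrow> 0) (at (0::real))"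
        using tendsto_rabs[OF tendsto_ident_at, of "0::real" UNIV] by simp
    qed
    then show ?thesis using 3 by (simp add: DERIV_def)
  qed
qed

lemma C1_on_mult:
  assumes "C1_on U f p" "C1_on U g q"
  shows "C1_on U (\<lambda>x. f x * g x) (\<lambda>x. g x *\<^sub>R p x + f x *\<^sub>R q x)"
  unfolding C1_on_def
proof (intro conjI ballI)
  fix x assume "x \<in> U"
  then have "(f has_derivative (\<lambda>v. p x \<bullet> v)) (at x)" "(g has_derivative (\<lambda>v. q x \<bullet> v)) (at x)"
    using assms by (auto simp: C1_on_def)
  from has_derivative_mult[OF this]
  show "((\<lambda>x. f x * g x) has_derivative (\<lambda>v. (g x *\<^sub>R p x + f x *\<^sub>R q x) \<bullet> v)) (at x)"
    by (rule has_derivative_eq_rhs) (simp add: fun_eq_iff inner_add_left mult.commute)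
next
  show "continuous_on U (\<lambda>x. g x *\<^sub>R p x + f x *\<^sub>R q x)"
    using assms C1_on_continuous[OF assms(1)] C1_on_continuous[OF assms(2)]
    by (auto simp: C1_on_def intro!: continuous_intros)
qed

text \<open>Serves to carry a cut-off function across the singularity that the cutoff removes: near
  that point both the function and its gradient are 0.\<close>

lemma C1_on_extend_zero:
  assumes "C1_on U f p" "open U" "open V" "\<And>x. x \<in> V \<Longrightarrow> f x = 0" "\<And>x. x \<in> V \<Longrightarrow> p x = 0" "W \<subseteq> U \<union> V"
  shows "C1_on W f p"
  unfolding C1_on_def
proof (intro conjI ballI)
  fix x assume "x \<in> W"
  then consider "x \<in> U" | "x \<in> V" using assms(6) by blast
  then show "(f has_derivative (\<lambda>v. p x \<bullet> v)) (at x)"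
  proof cases
    case 1
    then show ?thesis using assms(1) by (simp add: C1_on_def)
  next
    case 2
    have "((\<lambda>x. 0) has_derivative (\<lambda>v. p x \<bullet> v)) (at x)"
      using assms(5)[OF 2] by simp
    then show ?thesis
      by (rule has_derivative_transform_within_open[OF _ assms(3) 2]) (simp add: assms(4))
  qed
next
  have "continuous_on V p"
    using continuous_on_cong[OF refl, of V p "\<lambda>x. 0"] assms(5) by simp
  then have "continuous_on (U \<union> V) p"
    using assms by (intro continuous_on_open_Un) (auto simp: C1_on_def)
  then show "continuous_on W p" using assms(6) continuous_on_subset by blast
qed

text \<open>An explicit cutoff made from the squared positive part applied twice to a quadratic
  function. It is once continuously differentiable, which is all that the flux identity
  asks.\<close>

lemma bump_function:
  fixes y :: "real^3"
  assumes "\<rho> > 0"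
  obtains \<psi> p where "C1_on UNIV \<psi> p"
    and "\<And>x. norm (x - y) \<le> \<rho> / 2 \<Longrightarrow> \<psi> x = 1 \<and> p x = 0"
    and "\<And>x. norm (x - y) \<ge> \<rho> \<Longrightarrow> \<psi> x = 0 \<and> p x = 0"
proof -
  \<comment> \<open>With this constant \<tau> = 2 |x - y|^2 / \<rho>^2 - 1, which is negative up to
    radius \<rho> / 2 and at least 1 from radius \<rho> on.\<close>
  define k where "k = 2 / \<rho>\<^sup>2"
  define \<tau> where "\<tau> x = k * ((x - y) \<bullet> (x - y)) - 1" for x
  define \<psi> where "\<psi> x = (max 0 (1 - (max 0 (\<tau> x))\<^sup>2))\<^sup>2" for x
  define p where "p x = (- (8 * k * max 0 (1 - (max 0 (\<tau> x))\<^sup>2) * max 0 (\<tau> x))) *\<^sub>R (x - y)" for x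
  have \<tau>: "\<tau> x = k * (norm (x - y))\<^sup>2 - 1" for x
    by (simp add: \<tau>_def power2_norm_eq_inner)
  have "C1_on UNIV \<psi> p"
    unfolding C1_on_def
  proof (intro conjI ballI)
    fix x
    have "(\<tau> has_derivative (\<lambda>v. 2 * k * ((x - y) \<bullet> v))) (at x)"
      unfolding \<tau>_def[abs_def]
      by (auto intro!: derivative_eq_intros simp: fun_eq_iff inner_commute)
    from has_derivative_diff[OF has_derivative_const[of 1]
        has_derivative_compose_o[OF this has_real_derivative_max_0_squared[unfolded has_field_derivative_def]]]
    have "((\<lambda>x. 1 - (max 0 (\<tau> x))\<^sup>2) has_derivative (\<lambda>v. - (2 * max 0 (\<tau> x) * (2 * k * ((x - y) \<bullet> v))))) (at x)"
      by (simp add: o_def)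
    from has_derivative_compose_o[OF this has_real_derivative_max_0_squared[unfolded has_field_derivative_def]]
    show "(\<psi> has_derivative (\<lambda>v. p x \<bullet> v)) (at x)"
      unfolding \<psi>_def[abs_def] p_def
      by (rule has_derivative_eq_rhs) (simp add: fun_eq_iff)
  next
    show "continuous_on UNIV p"
      unfolding p_def \<tau>_def by (intro continuous_intros)
  qed
  moreover have "\<psi> x = 1 \<and> p x = 0" if "norm (x - y) \<le> \<rho> / 2" for x
  proof -
    have "(norm (x - y))\<^sup>2 \<le> (\<rho> / 2)\<^sup>2" using that by (intro power_mono) auto
    moreover have "(\<rho> / 2)\<^sup>2 = \<rho>\<^sup>2 / 4" by (simp add: power_divide)
    ultimately have "2 * (norm (x - y))\<^sup>2 \<le> \<rho>\<^sup>2"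
      using zero_le_power2[of "norm (x - y)"] by linarith
    then have "\<tau> x \<le> 0" using assms by (simp add: \<tau> k_def field_simps)
    then show ?thesis by (simp add: \<psi>_def p_def)
  qed
  moreover have "\<psi> x = 0 \<and> p x = 0" if "norm (x - y) \<ge> \<rho>" for x
  proof -
    have "\<rho>\<^sup>2 \<le> (norm (x - y))\<^sup>2" using that assms by (intro power_mono) auto
    then have "1 \<le> \<tau> x" using assms by (simp add: \<tau> k_def field_simps)
    then have "1 \<le> (max 0 (\<tau> x))\<^sup>2" by (simp add: one_le_power)
    then show ?thesis by (simp add: \<psi>_def p_def)
  qed
  ultimately show ?thesis by (rule that)
qed

section \<open>Shell integrals as Lebesgue integrals, and the flux at infinity\<close>

lemma flux_cong:
  assumes "r > 0" "\<And>x. norm (x - y) = r \<Longrightarrow> H x = H' x"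
  shows "flux i y H r = flux i y H' r"
proof -
  have "angular_integral (\<lambda>n. n $ i * H (y + r *\<^sub>R n)) = angular_integral (\<lambda>n. n $ i * H' (y + r *\<^sub>R n))"
    by (rule angular_integral_cong) (use assms in auto)
  then show ?thesis by (simp add: flux_def)
qed

lemma set_integrable_compact:
  fixes f :: "real^3 \<Rightarrow> real"
  shows "compact S \<Longrightarrow> continuous_on S f \<Longrightarrow> set_integrable lborel S f"
  unfolding set_integrable_def by (rule borel_integrable_compact)

lemma compact_shell: "compact (shell y a b)"
proof -
  have "shell y a b = cball y b - ball y a"
    by (auto simp: dist_norm norm_minus_commute)
  then show ?thesis by (simp add: compact_diff)
qed

lemma set_integral_shell_gradient:
  assumes H: "C1_on (- {y}) H g" and "0 < a" "a \<le> b"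
  shows "set_integrable lborel (shell y a b) (\<lambda>x. g x $ i)"
    and "(LINT x:shell y a b|lborel. g x $ i) = flux i y H b - flux i y H a"
proof -
  have "continuous_on (- {y}) (\<lambda>x. g x $ i)"
    using H by (auto simp: C1_on_def intro!: continuous_intros)
  then have "continuous_on (shell y a b) (\<lambda>x. g x $ i)"
    by (rule continuous_on_subset) (use \<open>0 < a\<close> in auto)
  then show *: "set_integrable lborel (shell y a b) (\<lambda>x. g x $ i)"
    by (rule set_integrable_compact[OF compact_shell])
  show "(LINT x:shell y a b|lborel. g x $ i) = flux i y H b - flux i y H a"
    using set_borel_integral_eq_integral(2)[OF *] integral_shell_gradient[OF assms] by simp
qed

lemma AE_not_in_sphere: "AE x in lborel. x \<notin> sphere (c :: real^3) r"
proof (rule AE_not_in)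
  show "sphere c r \<in> null_sets lborel"
    using negligible_sphere[of c r] by (simp add: negligible_iff_null_sets null_sets_completion_iff)
qed

text \<open>The decay is measured from the origin but the spheres are centred at \<open>y\<close>.
  For r > 2 |y| their points have norm at least r / 2, which costs a factor 4 against the surface
  factor r^2.\<close>

lemma flux_tendsto_0:
  assumes F: "F \<in> o[at_infinity](\<lambda>x. norm x powr (-2))" and cont: "\<And>r. r > R \<Longrightarrow> continuous_on (sphere 0 1) (\<lambda>n. F (y + r *\<^sub>R n))"
  shows "(flux i y F \<longlongrightarrow> 0) at_top"
proof (rule tendstoI)
  fix \<epsilon> :: real assume "\<epsilon> > 0"
  \<comment> \<open>Chosen so that the final bound r^2 * 2 pi^2 * (4 \<eta> / r^2) equals half of
    \<epsilon>.\<close>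
  define \<eta> where "\<eta> = \<epsilon> / (16 * pi\<^sup>2)"
  have \<eta>: "\<eta> > 0" using \<open>\<epsilon> > 0\<close> by (simp add: \<eta>_def)
  obtain b where b: "\<And>x. norm x \<ge> b \<Longrightarrow> \<bar>F x\<bar> \<le> \<eta> * norm x powr (-2)"
    using landau_o.smallD[OF F \<eta>] by (auto simp: eventually_at_infinity)
  have "\<forall>\<^sub>F r in at_top. r > max (max 1 R) (max (2 * b) (2 * norm y))"
    by (rule eventually_gt_at_top)
  then show "\<forall>\<^sub>F r in at_top. dist (flux i y F r) 0 < \<epsilon>"
  proof eventually_elim
    case (elim r)
    then have r: "r > 1" "r > R" "r > 2 * b" "r > 2 * norm y" by auto
    have "\<bar>angular_integral (\<lambda>n. n $ i * F (y + r *\<^sub>R n))\<bar> \<le> 2 * pi\<^sup>2 * (4 * \<eta> / r\<^sup>2)"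
    proof (rule angular_integral_bound)
      show "continuous_on (sphere 0 1) (\<lambda>n. n $ i * F (y + r *\<^sub>R n))"
        by (intro continuous_intros cont r)
      fix n :: "real^3" assume "n \<in> sphere 0 1"
      then have n: "norm n = 1" by simp
      have "r = norm (r *\<^sub>R n)" using n r by simp
      also have "\<dots> \<le> norm (y + r *\<^sub>R n) + norm y"
        using norm_triangle_ineq4[of "y + r *\<^sub>R n" y] by simp
      finally have *: "r / 2 \<le> norm (y + r *\<^sub>R n)" using r by simp
      have "\<bar>F (y + r *\<^sub>R n)\<bar> \<le> \<eta> * norm (y + r *\<^sub>R n) powr (-2)"
        by (rule b) (use * r in linarith)
      also have "norm (y + r *\<^sub>R n) powr (-2) \<le> (r / 2) powr (-2)"
        by (rule powr_mono2') (use * r in auto)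
      also have "(r / 2) powr (-2) = 4 / r\<^sup>2"
        using r by (simp add: powr_minus powr_numeral power_divide)
      finally have "\<bar>F (y + r *\<^sub>R n)\<bar> \<le> 4 * \<eta> / r\<^sup>2"
        using \<eta> by (simp add: mult.commute mult_left_mono)
      moreover have "\<bar>n $ i\<bar> \<le> 1" using component_le_norm_cart[of n i] n by simp
      ultimately have "\<bar>n $ i\<bar> * \<bar>F (y + r *\<^sub>R n)\<bar> \<le> 1 * (4 * \<eta> / r\<^sup>2)" by (intro mult_mono) auto
      then show "\<bar>n $ i * F (y + r *\<^sub>R n)\<bar> \<le> 4 * \<eta> / r\<^sup>2" by (simp add: abs_mult)
    qed
    then have "\<bar>flux i y F r\<bar> \<le> r\<^sup>2 * (2 * pi\<^sup>2 * (4 * \<eta> / r\<^sup>2))"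
      unfolding flux_def by (simp add: abs_mult mult_left_mono del: times_divide_eq_right)
    also have "\<dots> = \<epsilon> / 2" using r by (simp add: \<eta>_def)
    finally show ?case using \<open>\<epsilon> > 0\<close> by simp
  qed
qed

subsection \<open>The integral outside two balls\<close>

text \<open>Beyond a large radius this is the hypothesis at infinity. The rest sits in a ball minus
  two open balls, which is compact and avoids the singularities.\<close>

lemma set_integrable_outside_balls:
  fixes f :: "real^3 \<Rightarrow> real"
  assumes f: "continuous_on (- {y1, y2}) f" and inf: "integrable_near_infinity f" and "s > 0"
  shows "set_integrable lborel (- (cball y1 s \<union> cball y2 s)) f"
proof -
  obtain R where R: "set_integrable lborel {x. norm x > R} f"
    using inf by (auto simp: integrable_near_infinity_def)
  let ?K = "cball 0 R - ball y1 s - ball y2 s"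
  have "compact ?K" by (intro compact_diff) auto
  moreover have "continuous_on ?K f"
    by (rule continuous_on_subset[OF f]) (use \<open>s > 0\<close> in auto)
  ultimately have "set_integrable lborel ?K f" by (rule set_integrable_compact)
  then have "set_integrable lborel ({x. norm x > R} \<union> ?K) f"
    by (intro set_integrable_Un R) auto
  then show ?thesis
    by (rule set_integrable_subset) (auto simp: not_less)
qed

text \<open>The cutoff writes \<open>F\<close> as a piece supported near \<open>y1\<close> plus a
  piece vanishing near \<open>y1\<close>. Each is integrated over a shell about its own centre, and
  the outer radius of the second shell then goes to infinity.\<close>

lemma integral_outside_balls:
  fixes F :: "real^3 \<Rightarrow> real" and i :: 3
  assumes ne: "y1 \<noteq> y2" and smooth: "smooth_on (- {y1, y2}) F"
    and decay: "F \<in> o[at_infinity](\<lambda>x. norm x powr (-2))"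
    and inf: "integrable_near_infinity (partial i F)"
    and s: "0 < s" "s < dist y1 y2 / 4"
  shows "(LINT x:- (cball y1 s \<union> cball y2 s)|lborel. partial i F x) = - flux i y1 F s - flux i y2 F s"
proof -
  \<comment> \<open>Half the distance between the centres: the cutoff lives within \<rho> of
    \<open>y1\<close>, hence off the small ball about \<open>y2\<close>, and it equals 1 on the
    small ball about \<open>y1\<close> because s < \<rho> / 2.\<close>
  define \<rho> where "\<rho> = dist y1 y2 / 2"
  have \<rho>: "\<rho> > 0" "s < \<rho> / 2" "dist y1 y2 = 2 * \<rho>" using ne s by (auto simp: \<rho>_def)
  have tri: "norm (x - y1) + norm (x - y2) \<ge> 2 * \<rho>" "norm (x - y2) \<le> norm (x - y1) + 2 * \<rho>" for x
    using dist_triangle2[of y1 y2 x] dist_triangle[of x y2 y1] \<rho>(3)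
    by (auto simp: dist_norm norm_minus_commute)
  define D where "D = - (cball y1 s \<union> cball y2 s)"
  define G where "G x = (\<chi> i. partial i F x)" for x
  have F: "C1_on (- {y1, y2}) F G"
    unfolding G_def[abs_def] using smooth by (intro smooth_on_C1) (auto simp: open_Compl)
  have contF: "continuous_on (- {y1, y2}) F" by (rule C1_on_continuous[OF F])
  have contf: "continuous_on (- {y1, y2}) (partial i F)"
  proof -
    have "continuous_on (- {y1, y2}) (\<lambda>x. G x $ i)"
      using F by (auto simp: C1_on_def intro!: continuous_intros)
    then show ?thesis by (simp add: G_def)
  qed
  obtain \<psi> p where \<psi>: "C1_on UNIV \<psi> p"
    and near: "\<And>x. norm (x - y1) \<le> \<rho> / 2 \<Longrightarrow> \<psi> x = 1 \<and> p x = 0"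
    and far: "\<And>x. norm (x - y1) \<ge> \<rho> \<Longrightarrow> \<psi> x = 0 \<and> p x = 0"
    using bump_function[OF \<rho>(1), of y1] by metis
  have \<psi>1: "C1_on (- {y1, y2}) \<psi> p" and \<psi>2: "C1_on (- {y1, y2}) (\<lambda>x. 1 - \<psi> x) (\<lambda>x. - p x)"
    using \<psi> by (auto simp: C1_on_def intro!: derivative_eq_intros continuous_intros elim: continuous_on_subset)
  \<comment> \<open>\<open>H1\<close> is regular at \<open>y2\<close> and \<open>H2\<close> at \<open>y1\<close>, so each can be integrated over shells about one centre\<close>
  define H1 where "H1 x = \<psi> x * F x" for x
  define H2 where "H2 x = (1 - \<psi> x) * F x" for x
  define g1 where "g1 x = F x *\<^sub>R p x + \<psi> x *\<^sub>R G x" for x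
  define g2 where "g2 x = F x *\<^sub>R (- p x) + (1 - \<psi> x) *\<^sub>R G x" for x
  have sum: "partial i F x = g1 x $ i + g2 x $ i" for x
    by (simp add: g1_def g2_def G_def algebra_simps)
  have g1_far: "g1 x = 0" "H1 x = 0" if "norm (x - y1) \<ge> \<rho>" for x
    using far[OF that] by (simp_all add: g1_def H1_def)
  have g2_near: "g2 x = 0" "H2 x = 0" if "norm (x - y1) \<le> \<rho> / 2" for x
    using near[OF that] by (simp_all add: g2_def H2_def)
  have H1: "C1_on (- {y1}) H1 g1"
  proof (rule C1_on_extend_zero[where U = "- {y1, y2}" and V = "{x. \<rho> < norm (x - y1)}"])
    show "C1_on (- {y1, y2}) H1 g1"
      unfolding H1_def[abs_def] g1_def[abs_def] by (rule C1_on_mult[OF \<psi>1 F])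
    show "open {x. \<rho> < norm (x - y1)}" by (intro open_Collect_less continuous_intros)
    show "- {y1} \<subseteq> - {y1, y2} \<union> {x. \<rho> < norm (x - y1)}"
      using tri(1)[of y2] \<rho>(1) by auto
  qed (use g1_far in \<open>auto simp: open_Compl\<close>)
  have H2: "C1_on (- {y2}) H2 g2"
  proof (rule C1_on_extend_zero[where U = "- {y1, y2}" and V = "{x. norm (x - y1) < \<rho> / 2}"])
    show "C1_on (- {y1, y2}) H2 g2"
      unfolding H2_def[abs_def] g2_def[abs_def] by (rule C1_on_mult[OF \<psi>2 F])
    show "open {x. norm (x - y1) < \<rho> / 2}" by (intro open_Collect_less continuous_intros)
    show "- {y2} \<subseteq> - {y1, y2} \<union> {x. norm (x - y1) < \<rho> / 2}"
      using \<rho>(1) by auto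
  qed (use g2_near in \<open>auto simp: open_Compl\<close>)
  have flux1: "flux i y1 H1 s = flux i y1 F s"
    by (rule flux_cong) (use s near \<rho>(2) in \<open>auto simp: H1_def\<close>)
  \<comment> \<open>Spheres about \<open>y2\<close> of radius at most \<rho> or at least 3 \<rho>
    keep a distance of at least \<rho> from \<open>y1\<close>, so the cutoff vanishes on
    them.\<close>
  have flux2: "flux i y2 H2 r = flux i y2 F r" if "r > 0" "r \<le> \<rho> \<or> 3 * \<rho> \<le> r" for r
  proof (rule flux_cong[OF that(1)])
    fix x assume "norm (x - y2) = r"
    then have "\<psi> x = 0" using far[of x] tri[of x] that(2) by auto
    then show "H2 x = F x" by (simp add: H2_def)
  qed
  have flux1': "flux i y1 H1 \<rho> = 0"
  proof -
    have "flux i y1 H1 \<rho> = flux i y1 (\<lambda>x. 0) \<rho>"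
      by (rule flux_cong) (use g1_far \<rho>(1) in auto)
    then show ?thesis by (simp add: flux_def)
  qed
  have intD: "set_integrable lborel D (partial i F)"
    unfolding D_def by (rule set_integrable_outside_balls[OF contf inf s(1)])
  have meas: "D \<inter> cball y2 R \<in> sets lborel" for R
    unfolding D_def by auto
  \<comment> \<open>For R >= 3 \<rho> the ball about \<open>y2\<close> contains the whole support of
    the cutoff, so only \<open>F\<close> itself is seen on the outer sphere.\<close>
  have part: "(LINT x:D \<inter> cball y2 R|lborel. partial i F x) = flux i y2 F R - flux i y1 F s - flux i y2 F s"
    if R: "R \<ge> 3 * \<rho>" for R
  proof -
    have "s \<le> \<rho>" "s \<le> R" "R > 0" using \<rho> s R by auto
    note 1 = set_integral_shell_gradient[OF H1 s(1) \<open>s \<le> \<rho>\<close>, of i]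
    note 2 = set_integral_shell_gradient[OF H2 s(1) \<open>s \<le> R\<close>, of i]
    have "(LINT x:D \<inter> cball y2 R|lborel. partial i F x)
        = (\<integral>x. indicator (shell y1 s \<rho>) x *\<^sub>R g1 x $ i + indicator (shell y2 s R) x *\<^sub>R g2 x $ i \<partial>lborel)"
      unfolding set_lebesgue_integral_def
    proof (rule integral_cong_AE)
      show "(\<lambda>x. indicator (D \<inter> cball y2 R) x *\<^sub>R partial i F x) \<in> borel_measurable lborel"
        using set_integrable_subset[OF intD meas[of R]] unfolding set_integrable_def
        by (intro borel_measurable_integrable) auto
      show "(\<lambda>x. indicator (shell y1 s \<rho>) x *\<^sub>R g1 x $ i + indicator (shell y2 s R) x *\<^sub>R g2 x $ i) \<in> borel_measurable lborel"
        using 1(1) 2(1) unfolding set_integrable_def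
        by (intro borel_measurable_add borel_measurable_integrable)
      \<comment> \<open>The region omits the spheres of radius \<open>s\<close>, which the closed
        shells include; this is the exceptional null set. The second shell overlaps the ball about
        \<open>y1\<close>, but \<open>g2\<close> vanishes there.\<close>
      show "AE x in lborel. indicator (D \<inter> cball y2 R) x *\<^sub>R partial i F x
          = indicator (shell y1 s \<rho>) x *\<^sub>R g1 x $ i + indicator (shell y2 s R) x *\<^sub>R g2 x $ i"
        using AE_not_in_sphere[of y1 s] AE_not_in_sphere[of y2 s]
      proof eventually_elim
        case (elim x)
        then have x: "norm (x - y1) \<noteq> s" "norm (x - y2) \<noteq> s" by (auto simp: dist_norm norm_minus_commute)
        have D: "indicator (D \<inter> cball y2 R) x
            = (if s < norm (x - y1) \<and> s < norm (x - y2) \<and> norm (x - y2) \<le> R then 1 else 0 :: real)"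
          by (auto simp: D_def dist_norm norm_minus_commute)
        consider "norm (x - y1) < s" | "norm (x - y2) < s" | "norm (x - y2) > R"
          | "s < norm (x - y1)" "s < norm (x - y2)" "norm (x - y2) \<le> R"
          using x by linarith
        then show ?case
        proof cases
          case 1
          then have "g2 x = 0" using \<rho> by (intro g2_near) auto
          with 1 show ?thesis by (simp add: D)
        next
          case 2
          then have "g1 x = 0" using \<rho> tri[of x] by (intro g1_far) auto
          with 2 show ?thesis by (simp add: D)
        next
          case 3
          then have "g1 x = 0" using \<rho> tri[of x] R by (intro g1_far) auto
          with 3 show ?thesis by (simp add: D)
        next
          case 4
          then show ?thesis
            using g1_far[of x] by (cases "norm (x - y1) \<le> \<rho>") (simp_all add: D sum)
        qed
      qed
    qed
    also have "\<dots> = (LINT x:shell y1 s \<rho>|lborel. g1 x $ i) + (LINT x:shell y2 s R|lborel. g2 x $ i)"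
      using 1(1) 2(1) unfolding set_integrable_def set_lebesgue_integral_def
      by (rule Bochner_Integration.integral_add)
    also have "\<dots> = flux i y2 F R - flux i y1 F s - flux i y2 F s"
      using 1(2) 2(2) flux1 flux1' flux2[of R] flux2[of s] R \<open>R > 0\<close> \<open>s \<le> \<rho>\<close> s(1) by simp
    finally show ?thesis .
  qed
  \<comment> \<open>Balls of integer radius about \<open>y2\<close> exhaust the region, and
    integrability on it makes the truncated integrals converge to the full one.\<close>
  have Un: "(\<Union>n::nat. D \<inter> cball y2 (real n)) = D"
    using real_arch_simple by auto
  have "(\<lambda>n::nat. LINT x:D \<inter> cball y2 (real n)|lborel. partial i F x)
      \<longlonglongrightarrow> (LINT x:(\<Union>n::nat. D \<inter> cball y2 (real n))|lborel. partial i F x)"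
  proof (rule set_integral_cont_up)
    show "incseq (\<lambda>n. D \<inter> cball y2 (real n))"
      by (auto simp: incseq_def)
  qed (simp_all only: Un intD meas)
  then have lim1: "(\<lambda>n::nat. LINT x:D \<inter> cball y2 (real n)|lborel. partial i F x)
      \<longlonglongrightarrow> (LINT x:D|lborel. partial i F x)"
    by (simp only: Un)
  have "(flux i y2 F \<longlongrightarrow> 0) at_top"
  proof (rule flux_tendsto_0[OF decay])
    fix r :: real assume r: "r > 3 * \<rho>"
    show "continuous_on (sphere 0 1) (\<lambda>n. F (y2 + r *\<^sub>R n))"
    proof (rule continuous_on_compose2[OF contF])
      show "continuous_on (sphere 0 1) (\<lambda>n. y2 + r *\<^sub>R n)" by (intro continuous_intros)
      show "(\<lambda>n. y2 + r *\<^sub>R n) ` sphere 0 1 \<subseteq> - {y1, y2}"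
      proof (rule image_subsetI)
        fix n :: "real^3" assume "n \<in> sphere 0 1"
        then have "norm (y2 + r *\<^sub>R n - y2) = r" using r \<rho>(1) by simp
        then have "y2 + r *\<^sub>R n \<noteq> y2" "y2 + r *\<^sub>R n \<noteq> y1"
          using r \<rho>(1) tri(2)[of y1] by auto
        then show "y2 + r *\<^sub>R n \<in> - {y1, y2}" by simp
      qed
    qed
  qed
  then have "(\<lambda>n::nat. flux i y2 F (real n)) \<longlonglongrightarrow> 0"
    by (rule filterlim_compose[OF _ filterlim_real_sequentially])
  then have "(\<lambda>n::nat. flux i y2 F (real n) - flux i y1 F s - flux i y2 F s) \<longlonglongrightarrow> 0 - flux i y1 F s - flux i y2 F s"
    by (intro tendsto_intros)
  moreover have "\<forall>\<^sub>F n::nat in sequentially. flux i y2 F (real n) - flux i y1 F s - flux i y2 F s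
      = (LINT x:D \<inter> cball y2 (real n)|lborel. partial i F x)"
  proof -
    have "\<forall>\<^sub>F n::nat in sequentially. 3 * \<rho> \<le> real n"
      using filterlim_real_sequentially by (simp add: filterlim_at_top)
    then show ?thesis by eventually_elim (simp add: part)
  qed
  ultimately have "((\<lambda>n::nat. LINT x:D \<inter> cball y2 (real n)|lborel. partial i F x) \<longlonglongrightarrow> 0 - flux i y1 F s - flux i y2 F s)"
    by (rule Lim_transform_eventually)
  from LIMSEQ_unique[OF lim1 this] show ?thesis by (simp add: D_def)
qed

section \<open>Combining flux, counterterms and partie finie\<close>

lemma pf_point_weighted:
  assumes "smooth_expansion_at y F A c"
  shows "4 * pi * pf_point y (\<lambda>x. unit_dir y x $ i * norm (x - y) ^ 2 * F x)
    = angular_integral (\<lambda>n. n $ i * c (-2) n)"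
proof -
  have "expansion_at y F A c" "\<And>a. a \<in> A \<Longrightarrow> continuous_on (sphere 0 1) (c a)"
    using assms smooth_on_sphere_continuous by (auto simp: smooth_expansion_at_def)
  \<comment> \<open>The coefficient of r^0 after the shift by 2 is n^i times the coefficient of
    r^(-2) in \<open>F\<close>; the factor 4 pi undoes the averaging.\<close>
  from coeff_at_eq[OF expansion_at_weighted[OF this]] show ?thesis
    by (simp add: pf_point_def)
qed

text \<open>The counterterms of the derivative equal the divergent part of the flux, so their
  difference tends to minus the constant term, which is a partie finie at the point.\<close>

lemma flux_pf_counterterm:
  assumes E: "smooth_expansion_at y F A c"
    and U: "open U" "y \<in> U" "continuous_on (U - {y}) F"
  shows "((\<lambda>s. pf_counterterm y \<sigma> (partial i F) s - flux i y F s) \<longlongrightarrow>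
    - (4 * pi * pf_point y (\<lambda>x. unit_dir y x $ i * norm (x - y) ^ 2 * F x))) (at_right 0)"
proof -
  have "expansion_at y F A c" "\<And>a. a \<in> A \<Longrightarrow> continuous_on (sphere 0 1) (c a)"
    using E smooth_on_sphere_continuous by (auto simp: smooth_expansion_at_def)
  from tendsto_minus[OF flux_expansion[OF this U, of i]] show ?thesis
    by (simp add: pf_counterterm_partial[OF E] pf_point_weighted[OF E])
qed

theorem theorem1:
  fixes y1 y2 :: "real^3" and F :: "real^3 \<Rightarrow> real" and i :: 3 and s1 s2 :: real
  assumes "y1 \<noteq> y2"
    and "F \<in> class_F y1 y2"
    and "F \<in> o[at_infinity](\<lambda>x. norm x powr (-2))"
    and "integrable_near_infinity (partial i F)"
    and "s1 > 0" and "s2 > 0"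
  shows "has_pf_integral y1 y2 s1 s2 (partial i F)
    (- 4 * pi * pf_point y1 (\<lambda>x. unit_dir y1 x $ i * norm (x - y1) ^ 2 * F x)
     - 4 * pi * pf_point y2 (\<lambda>x. unit_dir y2 x $ i * norm (x - y2) ^ 2 * F x))"
proof -
  obtain A c B d where smooth: "smooth_on (- {y1, y2}) F"
    and E1: "smooth_expansion_at y1 F A c" and E2: "smooth_expansion_at y2 F B d"
    using assms(2) by (auto simp: class_F_def)
  have cont: "continuous_on (- {y1, y2}) F"
    by (rule C1_on_continuous[OF smooth_on_C1[OF _ smooth]]) (simp add: open_Compl)
  \<comment> \<open>The complement of the other singular point serves as the open neighbourhood in
    which \<open>F\<close> is continuous except at the centre.\<close>
  have U1: "continuous_on (- {y2} - {y1}) F" and U2: "continuous_on (- {y1} - {y2}) F"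
    by (rule continuous_on_subset[OF cont], auto)+
  have 1: "((\<lambda>s. pf_counterterm y1 s1 (partial i F) s - flux i y1 F s) \<longlongrightarrow>
      - (4 * pi * pf_point y1 (\<lambda>x. unit_dir y1 x $ i * norm (x - y1) ^ 2 * F x))) (at_right 0)"
    by (rule flux_pf_counterterm[OF E1 _ _ U1]) (use assms(1) in \<open>auto simp: open_Compl\<close>)
  have 2: "((\<lambda>s. pf_counterterm y2 s2 (partial i F) s - flux i y2 F s) \<longlongrightarrow>
      - (4 * pi * pf_point y2 (\<lambda>x. unit_dir y2 x $ i * norm (x - y2) ^ 2 * F x))) (at_right 0)"
    by (rule flux_pf_counterterm[OF E2 _ _ U2]) (use assms(1) in \<open>auto simp: open_Compl\<close>)
  have "\<forall>\<^sub>F s in at_right 0. s \<in> {0<..<dist y1 y2 / 4}"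
    by (rule eventually_at_right_real) (use assms(1) in simp)
  then have "\<forall>\<^sub>F s in at_right 0. (pf_counterterm y1 s1 (partial i F) s - flux i y1 F s)
      + (pf_counterterm y2 s2 (partial i F) s - flux i y2 F s)
    = (LINT x:- (cball y1 s \<union> cball y2 s)|lborel. partial i F x)
      + pf_counterterm y1 s1 (partial i F) s + pf_counterterm y2 s2 (partial i F) s"
  proof eventually_elim
    case (elim s)
    then have "0 < s" "s < dist y1 y2 / 4" by auto
    from integral_outside_balls[OF assms(1) smooth assms(3,4) this] show ?case by linarith
  qed
  from Lim_transform_eventually[OF tendsto_add[OF 1 2] this] show ?thesis
    by (simp add: has_pf_integral_def)
qed

end
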